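(* Let $T>0$ and $C\ge 0$ be real numbers, and let $\gamma:\mathbb{R}\to\mathbb{R}$ be a $2T$-periodic, locally absolutely continuous function of bounded variation over $[0,2T]$ in the sense that $$V_0^{2T}[\gamma]=\int_0^{2T}|\dot\gamma(t)|\,dt\le C.$$ For an integer $K\ge 1$, let $\hat\gamma_K(t)=\sum_{k=-K}^{K}c_k e^{i\pi k t/T}$ be the truncated Fourier series of $\gamma$ with $2K+1$ coefficients, where $c_k=\frac{1}{2T}\int_0^{2T}\gamma(t)e^{-i\pi k t/T}\,dt$. Then the square error $MSE=\int_0^{2T}(\gamma(t)-\hat\gamma_K(t))^2\,dt$ satisfies $$MSE\le \frac{T C^2}{\pi^2 K}.$$
   Context: $\dot\gamma$ denotes the (almost everywhere defined) derivative of $\gamma$, and $i$ is the imaginary unit. The quantity called $MSE$ is the unnormalized integral of the squared error over one period $[0,2T]$. *)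

theory Defs
  imports "HOL-Analysis.Analysis"
begin

text \<open>
  The usual epsilon-delta notion: \<open>d division_of s\<close> says that \<open>d\<close> is a finite family of
  non-overlapping nonempty compact intervals with union \<open>s\<close>; \<open>s\<close> itself need not be an interval.
  This is unrelated to \<^const>\<open>absolutely_continuous\<close>, which is about measures.
\<close>

definition abs_continuous_on :: "real set \<Rightarrow> (real \<Rightarrow> real) \<Rightarrow> bool" where
  "abs_continuous_on S f \<longleftrightarrow>
     (\<forall>\<epsilon>>0. \<exists>\<delta>>0. \<forall>d s. d division_of s \<and> s \<subseteq> S \<and> (\<Sum>k\<in>d. measure lborel k) < \<delta> \<longrightarrow>
        (\<Sum>k\<in>d. \<bar>f (Sup k) - f (Inf k)\<bar>) < \<epsilon>)"

definition locally_abs_continuous :: "(real \<Rightarrow> real) \<Rightarrow> bool" where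
  "locally_abs_continuous f \<longleftrightarrow> (\<forall>a b. abs_continuous_on {a..b} f)"

definition fourier_coeff :: "real \<Rightarrow> (real \<Rightarrow> real) \<Rightarrow> int \<Rightarrow> complex" where
  "fourier_coeff T \<gamma> k =
     1 / (2 * of_real T) *
     (LBINT t:{0..2*T}. of_real (\<gamma> t) * exp (- (\<i> * of_real pi * of_int k * of_real t / of_real T)))"

definition fourier_trunc :: "real \<Rightarrow> (real \<Rightarrow> real) \<Rightarrow> nat \<Rightarrow> real \<Rightarrow> complex" where
  "fourier_trunc T \<gamma> K t =
     (\<Sum>k=-int K..int K. fourier_coeff T \<gamma> k * exp (\<i> * of_real pi * of_int k * of_real t / of_real T))"

text \<open>
  The truncated series is complex by type but has real values, so the squared modulus
  below is the plain square of the error; this is \<open>fourier_error_square\<close>.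
\<close>

definition square_error :: "real \<Rightarrow> (real \<Rightarrow> real) \<Rightarrow> nat \<Rightarrow> real" where
  "square_error T \<gamma> K = (LBINT t:{0..2*T}. (cmod (of_real (\<gamma> t) - fourier_trunc T \<gamma> K t))\<^sup>2)"

lemma cnj_fourier_coeff: "cnj (fourier_coeff T \<gamma> k) = fourier_coeff T \<gamma> (- k)"
  unfolding fourier_coeff_def set_lebesgue_integral_def
  by (simp add: exp_cnj flip: Bochner_Integration.integral_cnj)

lemma fourier_trunc_real: "fourier_trunc T \<gamma> K t \<in> \<real>"
proof -
  have "cnj (fourier_trunc T \<gamma> K t) =
    (\<Sum>k=-int K..int K. fourier_coeff T \<gamma> (- k) * exp (\<i> * of_real pi * of_int (- k) * of_real t / of_real T))"
    unfolding fourier_trunc_def by (simp add: cnj_fourier_coeff exp_cnj)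
  also have "\<dots> = fourier_trunc T \<gamma> K t"
    unfolding fourier_trunc_def
    by (rule sum.reindex_bij_witness[of _ uminus uminus]) auto
  finally show ?thesis
    by (simp add: Reals_cnj_iff)
qed

lemma fourier_error_square:
  "complex_of_real ((cmod (of_real (\<gamma> t) - fourier_trunc T \<gamma> K t))\<^sup>2) =
     (of_real (\<gamma> t) - fourier_trunc T \<gamma> K t)\<^sup>2"
proof -
  obtain r where "fourier_trunc T \<gamma> K t = of_real r"
    using fourier_trunc_real Reals_cases by blast
  then show ?thesis
    by (metis norm_of_real of_real_diff of_real_power power2_abs)
qed

end

theory Submission
  imports Defs
begin

text \<open>
  Integrating by parts, \<open>\<bar>c\<^sub>k\<bar> \<le> V / (2 \<pi> \<bar>k\<bar>)\<close> with \<open>V = integral of \<bar>deriv \<gamma>\<bar>\<close>, and by Parseval the square error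
  is \<open>2 T\<close> times the sum of \<open>\<bar>c\<^sub>k\<bar>\<^sup>2\<close> over \<open>\<bar>k\<bar> > K\<close>, at most \<open>T V\<^sup>2 / \<pi>\<^sup>2\<close> times the sum of \<open>1 / k\<^sup>2\<close> over \<open>k > K\<close>.
  Parseval follows from the best approximation property of Fourier sums and
  Stone-Weierstrass on the circle.

  The integration by parts needs an absolutely continuous function to be differentiable almost
  everywhere and to be the integral of its derivative. Monotone decompositions can be avoided:
  if on a set of positive measure some difference quotients are below \<open>p\<close> and others above
  \<open>q > p\<close> at all small scales, cover almost all of the set by finitely many intervals of the first kind, and then
  by intervals of the second kind inside those. The remaining gaps have small total length,
  so by absolute continuity the increments over the two families nearly agree, a contradiction.
\<close>

section \<open>Increments of absolutely continuous functions\<close>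

definition increment :: "(real \<Rightarrow> real) \<Rightarrow> real set \<Rightarrow> real" where
  "increment f K = f (Sup K) - f (Inf K)"

lemma increment_Icc [simp]: "u \<le> v \<Longrightarrow> increment f {u..v} = f v - f u"
  by (simp add: increment_def)

lemma abs_continuous_onD:
  assumes "abs_continuous_on {a..b} f" "\<epsilon> > 0"
  shows "\<exists>\<delta>>0. \<forall>d. d division_of \<Union>d \<longrightarrow> \<Union>d \<subseteq> {a..b} \<longrightarrow> (\<Sum>K\<in>d. measure lborel K) < \<delta> \<longrightarrow>
       (\<Sum>K\<in>d. \<bar>increment f K\<bar>) < \<epsilon>"
proof -
  obtain \<delta> where "\<delta> > 0" and \<delta>: "\<forall>d s. d division_of s \<and> s \<subseteq> {a..b} \<and> (\<Sum>k\<in>d. measure lborel k) < \<delta> \<longrightarrow>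
        (\<Sum>k\<in>d. \<bar>f (Sup k) - f (Inf k)\<bar>) < \<epsilon>"
    using assms unfolding abs_continuous_on_def by blast
  then show ?thesis
    unfolding increment_def by blast
qed

lemma abs_continuous_on_short:
  assumes "abs_continuous_on {a..b} f" "\<epsilon> > 0"
  shows "\<exists>\<delta>>0. \<forall>u v. a \<le> u \<longrightarrow> u \<le> v \<longrightarrow> v \<le> b \<longrightarrow> v - u < \<delta> \<longrightarrow> \<bar>f v - f u\<bar> < \<epsilon>"
proof -
  obtain \<delta> where "\<delta> > 0" and \<delta>:
    "\<forall>d. d division_of \<Union>d \<longrightarrow> \<Union>d \<subseteq> {a..b} \<longrightarrow> (\<Sum>K\<in>d. measure lborel K) < \<delta> \<longrightarrow>
       (\<Sum>K\<in>d. \<bar>increment f K\<bar>) < \<epsilon>"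
    using abs_continuous_onD[OF assms] by blast
  show ?thesis
  proof (intro exI[of _ \<delta>] conjI allI impI \<open>\<delta> > 0\<close>)
    fix u v assume "a \<le> u" "u \<le> v" "v \<le> b" "v - u < \<delta>"
    then show "\<bar>f v - f u\<bar> < \<epsilon>"
      using \<delta>[rule_format, of "{{u..v}}"] division_of_self[of u v] by auto
  qed
qed

lemma abs_continuous_on_imp_continuous_on:
  assumes "abs_continuous_on {a..b} f"
  shows "continuous_on {a..b} f"
  unfolding continuous_on_iff
proof (intro ballI allI impI)
  fix x \<epsilon> :: real assume x: "x \<in> {a..b}" and "\<epsilon> > 0"
  obtain \<delta> where "\<delta> > 0" and \<delta>:
    "\<forall>u v. a \<le> u \<longrightarrow> u \<le> v \<longrightarrow> v \<le> b \<longrightarrow> v - u < \<delta> \<longrightarrow> \<bar>f v - f u\<bar> < \<epsilon>"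
    using abs_continuous_on_short[OF assms \<open>\<epsilon> > 0\<close>] by blast
  show "\<exists>d>0. \<forall>y\<in>{a..b}. dist y x < d \<longrightarrow> dist (f y) (f x) < \<epsilon>"
  proof (intro exI[of _ \<delta>] conjI ballI impI \<open>\<delta> > 0\<close>)
    fix y assume "y \<in> {a..b}" "dist y x < \<delta>"
    with x \<delta>[rule_format, of x y] \<delta>[rule_format, of y x] show "dist (f y) (f x) < \<epsilon>"
      by (cases "x \<le> y") (auto simp: dist_real_def abs_minus_commute)
  qed
qed

lemma abs_continuous_on_minus:
  "abs_continuous_on S f \<Longrightarrow> abs_continuous_on S (\<lambda>x. - f x)"
  unfolding abs_continuous_on_def by (simp add: abs_minus_commute)

lemma division_ofD_Icc:
  assumes "d division_of S" "K \<in> d"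
  shows "\<exists>u v::real. u \<le> v \<and> K = {u..v}"
proof -
  obtain u v where "K = cbox u v" using division_ofD(4)[OF assms] by blast
  with division_ofD(3)[OF assms] show ?thesis by auto
qed

lemma sum_increment_division:
  assumes "a \<le> b" "q division_of {a..b}"
  shows "(\<Sum>K\<in>q. increment f K) = f b - f a"
proof -
  \<comment> \<open>Tagging each interval with its left endpoint makes \<open>q\<close> a tagged
    division, for which the increments telescope.\<close>
  let ?t = "\<lambda>K. (Inf K, K)"
  have "Inf K \<in> K" if K: "K \<in> q" for K
  proof -
    obtain u v where "u \<le> v" "K = {u..v}" using division_ofD_Icc[OF assms(2) K] by blast
    then show ?thesis by simp
  qed
  have "?t ` q tagged_division_of {a..b}"
  proof (rule tagged_division_ofI)
    show "finite (?t ` q)" using assms(2) by blast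
    show "x \<in> K" "K \<subseteq> {a..b}" "\<exists>a b. K = cbox a b" if "(x, K) \<in> ?t ` q" for x K
      using that \<open>\<And>K. K \<in> q \<Longrightarrow> Inf K \<in> K\<close> division_ofD(2,4)[OF assms(2)] by (blast, blast, blast)
    show "interior K1 \<inter> interior K2 = {}"
      if "(x1, K1) \<in> ?t ` q" "(x2, K2) \<in> ?t ` q" "(x1, K1) \<noteq> (x2, K2)" for x1 K1 x2 K2
    proof -
      have "K1 \<in> q" "K2 \<in> q" "K1 \<noteq> K2" using that by auto
      then show ?thesis using division_ofD(5)[OF assms(2)] by blast
    qed
    have "{K. \<exists>x. (x, K) \<in> ?t ` q} = q" by auto
    then show "\<Union>{K. \<exists>x. (x, K) \<in> ?t ` q} = {a..b}" using division_ofD(6)[OF assms(2)] by simp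
  qed
  from additive_tagged_division_1[OF assms(1) this, of f] show ?thesis
    by (subst (asm) sum.reindex) (auto simp: inj_on_def increment_def)
qed

section \<open>Vitali coverings and extreme difference quotients\<close>

text \<open>
  Difference quotients are taken over intervals straddling the point: the set is then a
  countable intersection of open sets, with no assumption on the function.
\<close>

definition low_slope :: "(real \<Rightarrow> real) \<Rightarrow> real \<Rightarrow> real set" where
  "low_slope f p = {x. \<forall>d>0. \<exists>u v. u < x \<and> x < v \<and> v - u < d \<and> f v - f u < p * (v - u)}"

lemma low_slopeD:
  assumes "x \<in> low_slope f p" "d > 0"
  shows "\<exists>u v. u < x \<and> x < v \<and> v - u < d \<and> f v - f u < p * (v - u)"
  using assms unfolding low_slope_def by blast

lemma not_low_slopeD:
  assumes "x \<notin> low_slope f p"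
  shows "\<exists>d>0. \<forall>u v. u < x \<longrightarrow> x < v \<longrightarrow> v - u < d \<longrightarrow> p * (v - u) \<le> f v - f u"
  using assms unfolding low_slope_def mem_Collect_eq by (meson not_less)

lemma borel_low_slope: "low_slope f p \<in> sets borel"
proof -
  let ?A = "\<lambda>n::nat. {(u,v). v - u < inverse (real (Suc n)) \<and> f v - f u < p * (v - u)}"
  have "low_slope f p = (\<Inter>n. \<Union>(u,v)\<in>?A n. {u<..<v})" (is "_ = ?R")
  proof (intro equalityI subsetI)
    fix x assume x: "x \<in> low_slope f p"
    show "x \<in> ?R"
    proof
      fix n :: nat
      obtain u v where "u < x" "x < v" "v - u < inverse (real (Suc n))" "f v - f u < p * (v - u)"
        using x unfolding low_slope_def mem_Collect_eq by (meson inverse_positive_iff_positive of_nat_0_less_iff zero_less_Suc)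
      then have "(u, v) \<in> ?A n" "x \<in> {u<..<v}" by auto
      then show "x \<in> (\<Union>(u,v)\<in>?A n. {u<..<v})" by blast
    qed
  next
    fix x assume x: "x \<in> ?R"
    show "x \<in> low_slope f p" unfolding low_slope_def mem_Collect_eq
    proof (intro allI impI)
      fix d :: real assume "d > 0"
      then obtain n where n: "inverse (real (Suc n)) < d" using reals_Archimedean by blast
      from x obtain u v where "(u,v) \<in> ?A n" "x \<in> {u<..<v}" by blast
      with n show "\<exists>u v. u < x \<and> x < v \<and> v - u < d \<and> f v - f u < p * (v - u)"
        by (intro exI[of _ u] exI[of _ v]) auto
    qed
  qed
  also have "\<dots> \<in> sets borel"
    by (intro sets.countable_INT'' borel_open open_UN) auto
  finally show ?thesis .
qed

text \<open>Seen as balls around their midpoints, the admissible intervals inside \<open>U\<close>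
  form a Vitali covering of \<open>E\<close>, since \<open>U\<close> is open. A countable disjoint
  subfamily covers almost all of \<open>E\<close>, and continuity of measure leaves a finite one at
  the cost of \<open>\<eta>\<close>.\<close>

lemma Vitali_finite_division:
  fixes E U :: "real set"
  assumes E: "E \<in> lmeasurable" and U: "open U" "E \<subseteq> U" and "\<eta> > 0"
    and P: "\<forall>x\<in>E. \<forall>d>0. \<exists>u v. u < x \<and> x < v \<and> v - u < d \<and> P u v"
  shows "\<exists>d. d division_of \<Union>d \<and> \<Union>d \<subseteq> U \<and> (\<forall>K\<in>d. \<exists>u v. u < v \<and> K = {u..v} \<and> P u v) \<and>
    measure lebesgue E - \<eta> < measure lebesgue (E \<inter> \<Union>d)"
proof -
  define I where "I = {(u,v). u < v \<and> {u..v} \<subseteq> U \<and> P u v}"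
  define c where "c = (\<lambda>(u::real,v::real). (u + v) / 2)"
  define r where "r = (\<lambda>(u::real,v::real). (v - u) / 2)"
  have cb: "cball (c i) (r i) = {fst i..snd i}" for i
    by (cases i) (auto simp: c_def r_def cball_eq_atLeastAtMost field_simps)
  have 1: "\<exists>i. i \<in> I \<and> x \<in> cball (c i) (r i) \<and> r i < d" if x: "x \<in> E" and "d > 0" for x d
  proof -
    obtain e where e: "e > 0" "ball x e \<subseteq> U"
      using U x openE by blast
    obtain u v where uv: "u < x" "x < v" "v - u < min d e" "P u v"
      using P[rule_format, OF x, of "min d e"] e \<open>d > 0\<close> by auto
    have "{u..v} \<subseteq> ball x e" using uv by (auto simp: dist_real_def)
    then have "(u,v) \<in> I" using uv e by (auto simp: I_def)
    then show ?thesis using uv by (intro exI[of _ "(u,v)"]) (auto simp: cb, auto simp: r_def)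
  qed
  have 0: "0 < r i" if "i \<in> I" for i using that by (auto simp: I_def r_def)
  obtain C where C: "countable C" "C \<subseteq> I"
     and pw: "pairwise (\<lambda>i j. disjnt (cball (c i) (r i)) (cball (c j) (r j))) C"
     and neg: "negligible (E - (\<Union>i \<in> C. cball (c i) (r i)))"
    by (rule Vitali_covering_theorem_cballs[OF 0 1])
  \<comment> \<open>Cutting the intervals down to \<open>E\<close> bounds the measure of every
    finite union by that of \<open>E\<close>, the uniform bound required for the passage to a finite
    subfamily.\<close>
  define \<D> where "\<D> = (\<lambda>i. E \<inter> {fst i..snd i}) ` C"
  have "\<exists>D'\<subseteq>\<D>. finite D' \<and> measure lebesgue (\<Union>\<D>) - \<eta> < measure lebesgue (\<Union>D')"
  proof (rule measure_countable_Union_approachable[OF _ \<open>\<eta> > 0\<close>, of \<D> "measure lebesgue E"])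
    show "countable \<D>" using C by (simp add: \<D>_def)
    show lm: "d \<in> lmeasurable" if "d \<in> \<D>" for d
      using that E by (auto simp: \<D>_def intro!: fmeasurable.Int)
    show "measure lebesgue (\<Union>D') \<le> measure lebesgue E" if "D' \<subseteq> \<D>" "finite D'" for D'
      using that E lm by (intro measure_mono_fmeasurable) (auto simp: \<D>_def intro!: sets.finite_Union)
  qed blast
  then obtain D' where D': "D' \<subseteq> \<D>" "finite D'" "measure lebesgue (\<Union>\<D>) - \<eta> < measure lebesgue (\<Union>D')"
    by blast
  have mE: "measure lebesgue (\<Union>\<D>) = measure lebesgue E"
    using E neg by (intro measure_negligible_symdiff) (auto simp: \<D>_def cb elim!: negligible_subset)
  obtain C' where C': "C' \<subseteq> C" "finite C'" "D' = (\<lambda>i. E \<inter> {fst i..snd i}) ` C'"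
    using finite_subset_image[OF D'(2) D'(1)[unfolded \<D>_def]] by blast
  define d where "d = (\<lambda>i. {fst i..snd i}) ` C'"
  have disj: "K1 \<inter> K2 = {}" if "K1 \<in> d" "K2 \<in> d" "K1 \<noteq> K2" for K1 K2
  proof -
    obtain i j where "i \<in> C'" "j \<in> C'" "K1 = {fst i..snd i}" "K2 = {fst j..snd j}"
      using \<open>K1 \<in> d\<close> \<open>K2 \<in> d\<close> by (auto simp: d_def)
    moreover from this \<open>K1 \<noteq> K2\<close> have "i \<noteq> j" by auto
    ultimately show ?thesis
      using pw C'(1) unfolding pairwise_def cb disjnt_def by blast
  qed
  have I: "\<exists>u v. u < v \<and> K = {u..v} \<and> P u v \<and> {u..v} \<subseteq> U" if "K \<in> d" for K
  proof -
    obtain i where i: "i \<in> C'" "K = {fst i..snd i}" using \<open>K \<in> d\<close> unfolding d_def image_iff by blast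
    then have "i \<in> I" using C C' by blast
    then show ?thesis using i by (auto simp: I_def)
  qed
  show ?thesis
  proof (intro exI[of _ d] conjI ballI)
    show "d division_of \<Union>d"
    proof (rule division_ofI)
      show "finite d" using C' by (simp add: d_def)
      show "K \<noteq> {}" "\<exists>a b. K = cbox a b" if "K \<in> d" for K
        using I[OF that] by auto
      show "interior K1 \<inter> interior K2 = {}" if "K1 \<in> d" "K2 \<in> d" "K1 \<noteq> K2" for K1 K2
        using disj[OF that] interior_subset by blast
    qed auto
    show "\<Union>d \<subseteq> U" using I by blast
    show "\<exists>u v. u < v \<and> K = {u..v} \<and> P u v" if "K \<in> d" for K using I[OF that] by blast
    have "\<Union>D' = E \<inter> \<Union>d" by (auto simp: C' d_def)
    then show "measure lebesgue E - \<eta> < measure lebesgue (E \<inter> \<Union>d)"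
      using D' mE by simp
  qed
qed

lemma sum_content_division:
  fixes S :: "'a::euclidean_space set"
  assumes "d division_of S"
  shows "(\<Sum>K\<in>d. measure lborel K) = measure lebesgue S"
proof -
  have "(\<Sum>K\<in>d. measure lborel K) = (\<Sum>K\<in>d. measure lebesgue K)"
    using division_ofD(4)[OF assms] by (intro sum.cong) force+
  also have "\<dots> = measure lebesgue S" by (rule content_division[OF assms])
  finally show ?thesis .
qed

text \<open>
  Given nested partial divisions \<open>e\<close>, \<open>d\<close> of an interval, the same complementary intervals complete
  \<open>d\<close>, and together with the gaps \<open>g\<close> they complete \<open>e\<close>.
\<close>

lemma nested_division_gaps:
  assumes d: "d division_of \<Union>d" "\<Union>d \<subseteq> {a..b}" and e: "e division_of \<Union>e"
    and ed: "\<And>K. K \<in> e \<Longrightarrow> interior K \<noteq> {} \<and> (\<exists>J\<in>d. K \<subseteq> J)" and "a \<le> b"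
  obtains g where "g division_of \<Union>g" "\<Union>g \<subseteq> {a..b::real}"
    "\<And>f. (\<Sum>K\<in>d. increment f K) = (\<Sum>K\<in>e. increment f K) + (\<Sum>K\<in>g. increment f K)"
proof -
  obtain q where q: "d \<subseteq> q" "q division_of {a..b}"
    using partial_division_extend_interval[OF d(1)] d(2) by (metis box_real(2))
  define h where "h = q - d"
  have int: "interior K \<inter> interior L = {}" if "K \<in> e" "L \<in> h" for K L
  proof -
    obtain J where "J \<in> d" "K \<subseteq> J" using ed[OF \<open>K \<in> e\<close>] by blast
    moreover have "interior J \<inter> interior L = {}"
      using division_ofD(5)[OF q(2), of J L] \<open>J \<in> d\<close> \<open>L \<in> h\<close> q(1) by (auto simp: h_def)
    ultimately show ?thesis using interior_mono by blast
  qed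
  \<comment> \<open>A common member would have an interior disjoint from itself, hence empty;
    members of \<open>e\<close> have nonempty interior.\<close>
  have disj: "e \<inter> h = {}"
    using int ed by blast
  have fin: "finite q" using q(2) by blast
  have h: "h division_of \<Union>h"
    unfolding h_def by (rule division_of_subset[of q], subst division_ofD(6)[OF q(2)]) (use q(2) in blast)+
  have eh: "(e \<union> h) division_of \<Union>(e \<union> h)"
  proof (rule division_ofI)
    show "finite (e \<union> h)" using e h by blast
    show "K \<noteq> {}" "\<exists>a b. K = cbox a b" if "K \<in> e \<union> h" for K
      using that division_ofD(3,4)[OF e] division_ofD(3,4)[OF h] by blast+
    show "interior K1 \<inter> interior K2 = {}" if K: "K1 \<in> e \<union> h" "K2 \<in> e \<union> h" "K1 \<noteq> K2" for K1 K2
    proof -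
      consider "K1 \<in> e" "K2 \<in> e" | "K1 \<in> h" "K2 \<in> h" | "K1 \<in> e" "K2 \<in> h" | "K2 \<in> e" "K1 \<in> h"
        using K by blast
      then show ?thesis
        using division_ofD(5)[OF e _ _ K(3)] division_ofD(5)[OF h _ _ K(3)] int[of K1 K2] int[of K2 K1]
        by cases (simp_all add: inf_commute)
    qed
  qed auto
  have "\<Union>(e \<union> h) \<subseteq> {a..b}"
    using ed d(2) division_ofD(2)[OF q(2)] by (fastforce simp: h_def)
  then obtain q' where q': "e \<union> h \<subseteq> q'" "q' division_of {a..b}"
    using partial_division_extend_interval[OF eh] by (metis box_real(2))
  define g where "g = q' - (e \<union> h)"
  have fin': "finite q'" using q'(2) by blast
  show thesis
  proof
    show "g division_of \<Union>g"
      unfolding g_def by (rule division_of_subset[of q'], subst division_ofD(6)[OF q'(2)]) (use q'(2) in blast)+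
    show "\<Union>g \<subseteq> {a..b}"
      using division_ofD(2)[OF q'(2)] by (auto simp: g_def)
    fix f :: "real \<Rightarrow> real"
    let ?s = "\<lambda>S. \<Sum>K\<in>S. increment f K"
    have "?s d + ?s h = ?s q"
      using q(1) fin sum.subset_diff[of d q "increment f"] by (simp add: h_def)
    also have "\<dots> = ?s q'"
      using sum_increment_division[OF \<open>a \<le> b\<close>] q(2) q'(2) by simp
    also have "\<dots> = ?s g + ?s (e \<union> h)"
      using q'(1) fin' sum.subset_diff[of "e \<union> h" q' "increment f"] by (simp add: g_def)
    also have "?s (e \<union> h) = ?s e + ?s h"
      using disj e h by (intro sum.union_disjoint) auto
    finally show "?s d = ?s e + ?s g" by simp
  qed
qed

section \<open>Negligibility of the exceptional slopes\<close>

lemma sum_increment_id: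
  assumes "d division_of S"
  shows "(\<Sum>K\<in>d. increment (\<lambda>x. x) K) = (\<Sum>K\<in>d. measure lborel K)"
proof (rule sum.cong[OF refl])
  fix K assume "K \<in> d"
  then obtain u v where "u \<le> v" "K = {u..v}" using division_ofD_Icc[OF assms] by blast
  then show "increment (\<lambda>x. x) K = measure lborel K" by simp
qed

lemma sum_increment_less:
  assumes "d division_of S" and "\<And>K. K \<in> d \<Longrightarrow> \<exists>u v. u < v \<and> K = {u..v} \<and> f v - f u < p * (v - u)"
  shows "(\<Sum>K\<in>d. increment f K) \<le> p * (\<Sum>K\<in>d. measure lborel K)"
  unfolding sum_distrib_left
proof (rule sum_mono)
  fix K assume "K \<in> d"
  then obtain u v where "u < v" "K = {u..v}" "f v - f u < p * (v - u)" using assms(2) by blast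
  then show "increment f K \<le> p * measure lborel K" by simp
qed

text \<open>The family \<open>d\<close> has slopes below \<open>p\<close>, the family
  \<open>e\<close> nested in it has slopes above \<open>q\<close>, and both have total length close
  to the measure \<open>m\<close> of \<open>E\<close>. The increments over \<open>d\<close> and
  \<open>e\<close> differ only by those over the short gaps \<open>g\<close>, which absolute
  continuity makes small.\<close>

lemma negligible_oscillating_slope_aux:
  assumes ac: "abs_continuous_on {a..b} f" and "p < q"
    and E: "E \<subseteq> {a<..<b}" "E \<in> lmeasurable"
    and sub: "E \<subseteq> low_slope f p" "E \<subseteq> low_slope (\<lambda>x. - f x) (- q)"
  shows "negligible E"
proof (rule ccontr)
  define m where "m = measure lebesgue E"
  assume "\<not> negligible E"
  then have "m > 0" unfolding m_def
    using E(2) by (metis measure_nonneg negligible_iff_measure order_le_less)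
  then have "E \<noteq> {}" by (auto simp: m_def)
  then have "a \<le> b" using E by auto
  \<comment> \<open>The proof ends with (q - p) m / 2 on the left; \<open>\<epsilon>\<close> takes
    up half of it, and the error from the length of the gaps another quarter, which leaves a
    contradiction.\<close>
  define \<epsilon> where "\<epsilon> = (q - p) * m / 4"
  have "\<epsilon> > 0" using \<open>m > 0\<close> \<open>p < q\<close> by (simp add: \<epsilon>_def)
  obtain \<delta> where "\<delta> > 0" and \<delta>:
    "\<forall>d. d division_of \<Union>d \<longrightarrow> \<Union>d \<subseteq> {a..b} \<longrightarrow> (\<Sum>K\<in>d. measure lborel K) < \<delta> \<longrightarrow>
       (\<Sum>K\<in>d. \<bar>increment f K\<bar>) < \<epsilon>"
    using abs_continuous_onD[OF ac \<open>\<epsilon> > 0\<close>] by blast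
  \<comment> \<open>The three bounds serve in turn to keep the gaps, of length below 3 \<eta>,
    shorter than \<open>\<delta>\<close>; to keep \<open>e\<close> longer than m / 2; and to keep
    |p| * 3 \<eta> below (q - p) m / 8. The summand 1 avoids dividing by zero when \<open>p\<close>
    is 0.\<close>
  define \<eta> where "\<eta> = min (\<delta> / 3) (min (m / 4) ((q - p) * m / (24 * (\<bar>p\<bar> + 1))))"
  have "\<eta> > 0" using \<open>m > 0\<close> \<open>p < q\<close> \<open>\<delta> > 0\<close> by (simp add: \<eta>_def)
  have \<eta>: "3 * \<eta> \<le> \<delta>" "4 * \<eta> \<le> m" "24 * (\<bar>p\<bar> + 1) * \<eta> \<le> (q - p) * m"
  proof -
    show "3 * \<eta> \<le> \<delta>" "4 * \<eta> \<le> m" by (auto simp: \<eta>_def)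
    have "\<eta> \<le> (q - p) * m / (24 * (\<bar>p\<bar> + 1))" by (simp add: \<eta>_def)
    then show "24 * (\<bar>p\<bar> + 1) * \<eta> \<le> (q - p) * m"
      by (simp add: pos_le_divide_eq mult.commute)
  qed
  \<comment> \<open>Outer regularity: intervals chosen inside \<open>U\<close> cannot exceed the
    measure of \<open>E\<close> by \<open>\<eta>\<close> or more in total length.\<close>
  obtain U where U: "open U" "E \<subseteq> U" "U \<subseteq> {a<..<b}" "U \<in> lmeasurable" "measure lebesgue U < m + \<eta>"
  proof -
    obtain T where T: "open T" "E \<subseteq> T" "T - E \<in> lmeasurable" "emeasure lebesgue (T - E) < ennreal \<eta>"
      using sets_lebesgue_outer_open[OF _ \<open>\<eta> > 0\<close>] E(2) by (metis fmeasurableD)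
    let ?U = "T \<inter> {a<..<b}"
    have lm: "?U \<in> lmeasurable"
      using T(1) by (intro bounded_set_imp_lmeasurable) (auto simp: bounded_Int)
    have "measure lebesgue ?U \<le> measure lebesgue (E \<union> (T - E))"
      using T E lm by (intro measure_mono_fmeasurable fmeasurable.Un) auto
    also have "\<dots> \<le> m + measure lebesgue (T - E)"
      unfolding m_def using T E by (intro measure_Un_le) auto
    also have "measure lebesgue (T - E) < \<eta>"
      using T(3,4) \<open>\<eta> > 0\<close> by (simp add: emeasure_eq_measure2 ennreal_less_iff)
    finally show thesis using T E lm by (intro that[of ?U]) auto
  qed
  have P1: "\<forall>x\<in>E. \<forall>e>0. \<exists>u v. u < x \<and> x < v \<and> v - u < e \<and> f v - f u < p * (v - u)"
    using sub(1) low_slopeD by blast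
  obtain d where d: "d division_of \<Union>d" "\<Union>d \<subseteq> U"
    "\<forall>K\<in>d. \<exists>u v. u < v \<and> K = {u..v} \<and> f v - f u < p * (v - u)"
    "m - \<eta> < measure lebesgue (E \<inter> \<Union>d)"
    using Vitali_finite_division[OF E(2) U(1,2) \<open>\<eta> > 0\<close> P1, folded m_def] by blast
  \<comment> \<open>A point in the interior of a member of \<open>d\<close> has all its short
    straddling intervals inside that member, so the second Vitali family can be nested in
    \<open>d\<close>. Only finitely many endpoints are lost.\<close>
  define E' where "E' = E \<inter> (\<Union>K\<in>d. interior K)"
  have E'm: "E' \<in> lmeasurable"
    unfolding E'_def using E(2) by (intro fmeasurable_Int_fmeasurable) (auto intro!: sets_completionI_sets borel_open open_UN)
  have lmd: "E \<inter> \<Union>d \<in> lmeasurable"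
    using E(2) lmeasurable_division[OF d(1)] by (rule fmeasurable.Int)
  have mE': "measure lebesgue E' = measure lebesgue (E \<inter> \<Union>d)"
  proof (rule measure_negligible_symdiff[OF lmd])
    have "negligible (\<Union>K\<in>d. frontier K)"
    proof (rule negligible_Union)
      show "finite (frontier ` d)" using division_ofD(1)[OF d(1)] by simp
      show "negligible K" if K: "K \<in> frontier ` d" for K
      proof -
        obtain L where "L \<in> d" "K = frontier L" using K by blast
        moreover obtain u v where "L = {u..v}" using division_ofD_Icc[OF d(1) \<open>L \<in> d\<close>] by blast
        ultimately show ?thesis by (simp add: negligible_convex_frontier)
      qed
    qed
    moreover have "E \<inter> \<Union>d - E' \<union> (E' - E \<inter> \<Union>d) \<subseteq> (\<Union>K\<in>d. frontier K)"
    proof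
      fix x assume x: "x \<in> E \<inter> \<Union>d - E' \<union> (E' - E \<inter> \<Union>d)"
      then obtain K where "K \<in> d" "x \<in> K" "x \<notin> interior K"
        using interior_subset unfolding E'_def by blast
      then show "x \<in> (\<Union>K\<in>d. frontier K)"
        using closure_subset[of K] by (auto simp: frontier_def)
    qed
    ultimately show "negligible (E \<inter> \<Union>d - E' \<union> (E' - E \<inter> \<Union>d))"
      by (rule negligible_subset)
  qed
  have P2: "\<forall>x\<in>E'. \<forall>e>0. \<exists>u v. u < x \<and> x < v \<and> v - u < e \<and> (- f v - - f u < - q * (v - u) \<and> (\<exists>J\<in>d. {u..v} \<subseteq> J))"
  proof (intro ballI allI impI)
    fix x e :: real assume x: "x \<in> E'" and "e > 0"
    obtain J where J: "J \<in> d" "x \<in> interior J" using x by (auto simp: E'_def)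
    then obtain r where r: "r > 0" "ball x r \<subseteq> J" by (auto simp: mem_interior)
    have "x \<in> low_slope (\<lambda>x. - f x) (- q)" using x sub(2) by (auto simp: E'_def)
    then obtain u v where uv: "u < x" "x < v" "v - u < min r e" "- f v - - f u < - q * (v - u)"
      using low_slopeD[of x "\<lambda>x. - f x" "- q" "min r e"] \<open>r > 0\<close> \<open>e > 0\<close> by auto
    have "{u..v} \<subseteq> ball x r" using uv by (auto simp: dist_real_def)
    with r have "{u..v} \<subseteq> J" by blast
    with J uv show "\<exists>u v. u < x \<and> x < v \<and> v - u < e \<and> (- f v - - f u < - q * (v - u) \<and> (\<exists>J\<in>d. {u..v} \<subseteq> J))"
      by auto
  qed
  have E'U: "E' \<subseteq> U" using U(2) by (auto simp: E'_def)
  obtain e where e: "e division_of \<Union>e" "\<Union>e \<subseteq> U"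
    "\<forall>K\<in>e. \<exists>u v. u < v \<and> K = {u..v} \<and> (- f v - - f u < - q * (v - u) \<and> (\<exists>J\<in>d. {u..v} \<subseteq> J))"
    "measure lebesgue E' - \<eta> < measure lebesgue (E' \<inter> \<Union>e)"
    using Vitali_finite_division[OF E'm U(1) E'U \<open>\<eta> > 0\<close> P2] by (elim exE conjE) (rule that)
  have ed: "interior K \<noteq> {} \<and> (\<exists>J\<in>d. K \<subseteq> J)" if K: "K \<in> e" for K
  proof -
    obtain u v where "u < v" "K = {u..v}" "\<exists>J\<in>d. {u..v} \<subseteq> J"
      using bspec[OF e(3) K] by (elim exE conjE) (rule that)
    then show ?thesis by simp
  qed
  have "\<Union>d \<subseteq> {a..b}" using d(2) U(3) by force
  from nested_division_gaps[OF d(1) this e(1) ed \<open>a \<le> b\<close>]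
  obtain g where g: "g division_of \<Union>g" "\<Union>g \<subseteq> {a..b}"
    "\<And>f. (\<Sum>K\<in>d. increment f K) = (\<Sum>K\<in>e. increment f K) + (\<Sum>K\<in>g. increment f K)"
    by blast
  let ?m = "\<lambda>d. \<Sum>K\<in>d. measure lborel K"
  have len: "?m d = ?m e + ?m g"
    using g(3)[of "\<lambda>x. x"] by (simp add: sum_increment_id[OF d(1)] sum_increment_id[OF e(1)] sum_increment_id[OF g(1)])
  have "?m d \<le> measure lebesgue U"
    unfolding sum_content_division[OF d(1)] using lmeasurable_division[OF d(1)] d(2) U(4)
    by (intro measure_mono_fmeasurable fmeasurableD) auto
  then have md: "?m d < m + \<eta>" using U by simp
  have "measure lebesgue (E' \<inter> \<Union>e) \<le> ?m e"
    unfolding sum_content_division[OF e(1)] using lmeasurable_division[OF e(1)] E'm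
    by (intro measure_mono_fmeasurable sets.Int fmeasurableD) auto
  then have me: "?m e > m - 2 * \<eta>" using e(4) d(4) mE' by simp
  \<comment> \<open>The gaps have length |d| - |e| < (m + \<eta>) - (m - 2 \<eta>) = 3
    \<eta>.\<close>
  have "?m g < \<delta>" using md me len \<eta>(1) by simp
  then have "(\<Sum>K\<in>g. \<bar>increment f K\<bar>) < \<epsilon>" using \<delta> g by blast
  then have 1: "\<bar>\<Sum>K\<in>g. increment f K\<bar> < \<epsilon>" using sum_abs[of "increment f" g] by linarith
  have 2: "(\<Sum>K\<in>d. increment f K) \<le> p * ?m d"
    by (rule sum_increment_less[OF d(1)]) (use d(3) in blast)
  have "(\<Sum>K\<in>e. increment (\<lambda>x. - f x) K) \<le> - q * ?m e"
    by (rule sum_increment_less[OF e(1)]) (use e(3) in blast)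
  then have 3: "q * ?m e \<le> (\<Sum>K\<in>e. increment f K)"
    by (simp add: increment_def sum_negf flip: sum_subtractf) (simp add: sum_subtractf)
  have "0 \<le> ?m g" by (simp add: sum_nonneg)
  then have "p * ?m g \<le> \<bar>p\<bar> * (3 * \<eta>)"
    using md me len by (intro mult_mono) auto
  \<comment> \<open>Chain: q |e| is at most the sum over \<open>e\<close>, which is the sum over
    \<open>d\<close> minus that over \<open>g\<close>, hence at most p (|e| + |g|) +
    \<epsilon>.\<close>
  moreover have "(q - p) * ?m e \<le> p * ?m g + \<epsilon>"
    using 1 2 3 g(3)[of f] unfolding len by (simp add: algebra_simps)
  moreover have "(q - p) * (m / 2) \<le> (q - p) * ?m e"
    using \<open>p < q\<close> me \<eta>(2) by (intro mult_left_mono) auto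
  moreover have "8 * (\<bar>p\<bar> * (3 * \<eta>)) \<le> (q - p) * m"
    using \<eta>(3) \<open>\<eta> > 0\<close> by (simp add: algebra_simps)
  moreover have "(q - p) * m > 0" using \<open>p < q\<close> \<open>m > 0\<close> by simp
  ultimately show False unfolding \<epsilon>_def by simp
qed

lemma negligible_oscillating_slope:
  assumes "locally_abs_continuous f" and "p < q"
  shows "negligible (low_slope f p \<inter> low_slope (\<lambda>x. - f x) (- q))"
  unfolding negligible_on_intervals[of "low_slope f p \<inter> _"]
proof (intro allI)
  fix a b :: real
  let ?E = "low_slope f p \<inter> low_slope (\<lambda>x. - f x) (- q)"
  have "negligible (?E \<inter> {a<..<b})"
  proof (rule negligible_oscillating_slope_aux)
    show "abs_continuous_on {a..b} f" using assms by (simp add: locally_abs_continuous_def)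
    show "?E \<inter> {a<..<b} \<in> lmeasurable"
      by (intro bounded_set_imp_lmeasurable) (auto simp: bounded_Int intro!: sets.Int sets.countable_INT sets_completionI_sets borel_low_slope)
  qed (use assms in auto)
  then have "negligible ((?E \<inter> {a<..<b}) \<union> {a, b})" by (simp add: negligible_Un)
  then show "negligible (?E \<inter> cbox a b)" by (rule negligible_subset) auto
qed

text \<open>If \<open>E\<close> had measure m > 0, finitely many disjoint intervals of slope below
  -n would have total length above m / 2, and so total increment below -n m / 2. For n > 2 / m this
  violates the variation bound 1.\<close>

lemma negligible_infinite_slope_aux:
  assumes var: "\<And>d. d division_of \<Union>d \<Longrightarrow> \<Union>d \<subseteq> {a..b} \<Longrightarrow> (\<Sum>K\<in>d. \<bar>increment f K\<bar>) \<le> 1"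
    and E: "E \<subseteq> {a<..<b}" "E \<in> lmeasurable"
    and sub: "\<And>n::nat. E \<subseteq> low_slope f (- real n)"
  shows "negligible E"
proof (rule ccontr)
  define m where "m = measure lebesgue E"
  assume "\<not> negligible E"
  then have "m > 0" unfolding m_def
    using E(2) by (metis measure_nonneg negligible_iff_measure order_le_less)
  then obtain n where n: "2 / m < real n" using reals_Archimedean2 by blast
  have P: "\<forall>x\<in>E. \<forall>e>0. \<exists>u v. u < x \<and> x < v \<and> v - u < e \<and> f v - f u < - real n * (v - u)"
    using sub low_slopeD by blast
  have "m / 2 > 0" using \<open>m > 0\<close> by simp
  obtain d where d: "d division_of \<Union>d" "\<Union>d \<subseteq> {a<..<b}"
    "\<forall>K\<in>d. \<exists>u v. u < v \<and> K = {u..v} \<and> f v - f u < - real n * (v - u)"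
    "m - m / 2 < measure lebesgue (E \<inter> \<Union>d)"
    using Vitali_finite_division[OF E(2) open_greaterThanLessThan E(1) \<open>m / 2 > 0\<close> P, folded m_def] by blast
  let ?m = "\<Sum>K\<in>d. measure lborel K"
  have "measure lebesgue (E \<inter> \<Union>d) \<le> ?m"
    unfolding sum_content_division[OF d(1)] using lmeasurable_division[OF d(1)] E(2)
    by (intro measure_mono_fmeasurable sets.Int fmeasurableD) auto
  then have "real n * (m / 2) \<le> real n * ?m" using d(4) by (intro mult_left_mono) auto
  moreover have "(\<Sum>K\<in>d. increment f K) \<le> - real n * ?m"
    by (rule sum_increment_less[OF d(1)]) (use d(3) in blast)
  moreover have "\<Union>d \<subseteq> {a..b}" using d(2) by force
  then have "(\<Sum>K\<in>d. \<bar>increment f K\<bar>) \<le> 1" using var d(1) by blast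
  then have "- 1 \<le> (\<Sum>K\<in>d. increment f K)" using sum_abs[of "increment f" d] by linarith
  moreover have "real n * (m / 2) > 1" using n \<open>m > 0\<close> by (simp add: field_simps)
  ultimately show False by linarith
qed

text \<open>This is absolute continuity on \<open>{x-1..x+1}\<close> with 1 as the error. It
  provides the variation bound on short intervals, from which bisection arguments reach arbitrary
  ones.\<close>

lemma abs_continuous_on_bounded_variation_short:
  assumes "locally_abs_continuous f"
  shows "\<exists>\<delta>>0. \<forall>c d. c \<le> x \<longrightarrow> x \<le> d \<longrightarrow> d - c < \<delta> \<longrightarrow>
    (\<forall>D. D division_of \<Union>D \<longrightarrow> \<Union>D \<subseteq> {c..d} \<longrightarrow> (\<Sum>K\<in>D. \<bar>increment f K\<bar>) \<le> 1)"
proof -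
  have "abs_continuous_on {x-1..x+1} f" using assms by (simp add: locally_abs_continuous_def)
  from abs_continuous_onD[OF this, of 1] obtain \<delta> where "\<delta> > 0" and \<delta>:
    "\<forall>d. d division_of \<Union>d \<longrightarrow> \<Union>d \<subseteq> {x-1..x+1} \<longrightarrow> (\<Sum>K\<in>d. measure lborel K) < \<delta> \<longrightarrow>
       (\<Sum>K\<in>d. \<bar>increment f K\<bar>) < 1" by auto
  show ?thesis
  proof (intro exI[of _ "min \<delta> 1"] conjI allI impI)
    fix c d D assume c: "c \<le> x" "x \<le> d" "d - c < min \<delta> 1" and D: "D division_of \<Union>D" "\<Union>D \<subseteq> {c..d}"
    have "(\<Sum>K\<in>D. measure lborel K) \<le> measure lborel {c..d}"
      using subadditive_content_division[OF D(1), of c d] D(2) by simp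
    then have "(\<Sum>K\<in>D. measure lborel K) < \<delta>" using c by simp
    moreover have "\<Union>D \<subseteq> {x-1..x+1}" using D(2) c by force
    ultimately show "(\<Sum>K\<in>D. \<bar>increment f K\<bar>) \<le> 1" using \<delta> D(1) by (meson less_imp_le)
  qed (use \<open>\<delta> > 0\<close> in auto)
qed

lemma negligible_infinite_slope:
  assumes "locally_abs_continuous f"
  shows "negligible (\<Inter>n::nat. low_slope f (- real n))" (is "negligible ?E")
  unfolding negligible_on_intervals[of ?E]
proof (intro allI)
  fix a b :: real
  show "negligible (?E \<inter> cbox a b)"
  proof (cases "a \<le> b")
    case True
    then show ?thesis unfolding box_real
    \<comment> \<open>Bisection: a property of intervals that passes to unions of adjacent ones and
      holds on all short intervals around each point holds on \<open>{a..b}\<close>.\<close>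
    proof (induction rule: Bolzano)
      case (trans a b c)
      then have "?E \<inter> {a..c} = ?E \<inter> {a..b} \<union> ?E \<inter> {b..c}" by auto
      then show ?case using trans by (simp only: negligible_Un)
    next
      case (local x)
      obtain \<delta> where "\<delta> > 0" and \<delta>: "\<forall>c d. c \<le> x \<longrightarrow> x \<le> d \<longrightarrow> d - c < \<delta> \<longrightarrow>
         (\<forall>D. D division_of \<Union>D \<longrightarrow> \<Union>D \<subseteq> {c..d} \<longrightarrow> (\<Sum>K\<in>D. \<bar>increment f K\<bar>) \<le> 1)"
        using abs_continuous_on_bounded_variation_short[OF assms] by blast
      show ?case
      proof (intro exI[of _ \<delta>] conjI allI impI \<open>\<delta> > 0\<close>)
        fix c d assume cd: "c \<le> x \<and> x \<le> d \<and> d - c < \<delta>"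
        have "negligible (?E \<inter> {c<..<d})"
        proof (rule negligible_infinite_slope_aux)
          show "(\<Sum>K\<in>D. \<bar>increment f K\<bar>) \<le> 1" if "D division_of \<Union>D" "\<Union>D \<subseteq> {c..d}" for D
            using \<delta> cd that by blast
          show "?E \<inter> {c<..<d} \<in> lmeasurable"
            by (intro bounded_set_imp_lmeasurable) (auto simp: bounded_Int intro!: sets.Int sets.countable_INT sets_completionI_sets borel_low_slope)
        qed auto
        then have "negligible ((?E \<inter> {c<..<d}) \<union> {c, d})" by (simp add: negligible_Un)
        then show "negligible (?E \<inter> {c..d})" by (rule negligible_subset) auto
      qed
    qed
  qed auto
qed

section \<open>Differentiability almost everywhere\<close>

text \<open>The linearization errors at \<open>u\<close> and \<open>v\<close> are proportional to x
  - u and v - x, which add up to v - u because \<open>x\<close> lies between.\<close>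

lemma DERIV_straddle:
  fixes f :: "real \<Rightarrow> real"
  assumes "(f has_real_derivative D) (at x)" "\<epsilon> > 0"
  shows "\<exists>d>0. \<forall>u v. u < x \<longrightarrow> x < v \<longrightarrow> v - u < d \<longrightarrow> \<bar>f v - f u - D * (v - u)\<bar> \<le> \<epsilon> * (v - u)"
proof -
  have "\<exists>d>0. \<forall>y. norm (y - x) < d \<longrightarrow> norm (f y - f x - D * (y - x)) \<le> \<epsilon> * norm (y - x)"
    using assms unfolding has_field_derivative_def has_derivative_at_alt by blast
  then obtain d where "d > 0" and d: "\<And>y. \<bar>y - x\<bar> < d \<Longrightarrow> \<bar>f y - f x - D * (y - x)\<bar> \<le> \<epsilon> * \<bar>y - x\<bar>"
    by auto
  show ?thesis
  proof (intro exI[of _ d] conjI allI impI \<open>d > 0\<close>)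
    fix u v assume "u < x" "x < v" "v - u < d"
    then have "\<bar>f v - f x - D * (v - x)\<bar> \<le> \<epsilon> * (v - x)" "\<bar>f u - f x - D * (u - x)\<bar> \<le> \<epsilon> * (x - u)"
      using d[of v] d[of u] by auto
    then show "\<bar>f v - f u - D * (v - u)\<bar> \<le> \<epsilon> * (v - u)"
      by (simp add: algebra_simps abs_le_iff)
  qed
qed

lemma DERIV_le_low_slope:
  assumes "(f has_real_derivative D) (at x)" "x \<in> low_slope f p"
  shows "D \<le> p"
proof (rule ccontr)
  assume "\<not> D \<le> p"
  then obtain d where "d > 0" and d: "\<And>u v. u < x \<Longrightarrow> x < v \<Longrightarrow> v - u < d \<Longrightarrow> \<bar>f v - f u - D * (v - u)\<bar> \<le> (D - p) * (v - u)"
    using DERIV_straddle[OF assms(1), of "D - p"] by auto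
  obtain u v where "u < x" "x < v" "v - u < d" "f v - f u < p * (v - u)"
    using low_slopeD[OF assms(2) \<open>d > 0\<close>] by blast
  with d[of u v] show False by (simp add: algebra_simps abs_le_iff)
qed

text \<open>Converse of \<open>DERIV_straddle\<close>: by continuity one endpoint of a straddling
  interval may tend to \<open>x\<close>, and the estimate survives in the limit as the one for a
  difference quotient based at \<open>x\<close>.\<close>

lemma DERIV_straddleI:
  fixes f :: "real \<Rightarrow> real"
  assumes cont: "isCont f x"
    and str: "\<And>\<epsilon>. \<epsilon> > 0 \<Longrightarrow> \<exists>d>0. \<forall>u v. u < x \<longrightarrow> x < v \<longrightarrow> v - u < d \<longrightarrow> \<bar>f v - f u - D * (v - u)\<bar> \<le> \<epsilon> * (v - u)"
  shows "(f has_real_derivative D) (at x)"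
  unfolding has_field_derivative_def has_derivative_at_alt
proof (intro conjI allI impI)
  show "bounded_linear ((*) D)" by (rule bounded_linear_mult_right)
  fix \<epsilon> :: real assume "\<epsilon> > 0"
  then obtain d where "d > 0" and d: "\<And>u v. u < x \<Longrightarrow> x < v \<Longrightarrow> v - u < d \<Longrightarrow> \<bar>f v - f u - D * (v - u)\<bar> \<le> \<epsilon> * (v - u)"
    using str by blast
  show "\<exists>d>0. \<forall>y. norm (y - x) < d \<longrightarrow> norm (f y - f x - D * (y - x)) \<le> \<epsilon> * norm (y - x)"
  proof (intro exI[of _ d] conjI allI impI \<open>d > 0\<close>)
    fix y assume y: "norm (y - x) < d"
    have tl: "(f \<longlongrightarrow> f x) (at_left x)" and tr: "(f \<longlongrightarrow> f x) (at_right x)"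
      using cont unfolding isCont_def by (auto simp: filterlim_at_split)
    consider "y = x" | "y > x" | "y < x" by linarith
    then show "norm (f y - f x - D * (y - x)) \<le> \<epsilon> * norm (y - x)"
    proof cases
      case 2
      \<comment> \<open>The right endpoint \<open>y\<close> stays fixed while the left endpoint
        \<open>u\<close> increases to \<open>x\<close>; u > y - d keeps the interval shorter than
        \<open>d\<close>.\<close>
      have "\<bar>f y - f x - D * (y - x)\<bar> \<le> \<epsilon> * (y - x)"
      proof (rule tendsto_le)
        show "((\<lambda>u. \<epsilon> * (y - u)) \<longlongrightarrow> \<epsilon> * (y - x)) (at_left x)" by (intro tendsto_intros)
        show "((\<lambda>u. \<bar>f y - f u - D * (y - u)\<bar>) \<longlongrightarrow> \<bar>f y - f x - D * (y - x)\<bar>) (at_left x)"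
          by (intro tendsto_intros tl)
        show "\<forall>\<^sub>F u in at_left x. \<bar>f y - f u - D * (y - u)\<bar> \<le> \<epsilon> * (y - u)"
          unfolding eventually_at_left_field
          using d[of _ y] 2 y by (intro exI[of _ "y - d"]) auto
      qed simp
      then show ?thesis using 2 by simp
    next
      case 3
      have "\<bar>f x - f y - D * (x - y)\<bar> \<le> \<epsilon> * (x - y)"
      proof (rule tendsto_le)
        show "((\<lambda>u. \<epsilon> * (u - y)) \<longlongrightarrow> \<epsilon> * (x - y)) (at_right x)" by (intro tendsto_intros)
        show "((\<lambda>u. \<bar>f u - f y - D * (u - y)\<bar>) \<longlongrightarrow> \<bar>f x - f y - D * (x - y)\<bar>) (at_right x)"
          by (intro tendsto_intros tr)
        show "\<forall>\<^sub>F u in at_right x. \<bar>f u - f y - D * (u - y)\<bar> \<le> \<epsilon> * (u - y)"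
          unfolding eventually_at_right_field
          using d[of y] 3 y by (intro exI[of _ "y + d"]) auto
      qed simp
      moreover have "\<bar>f x - f y - D * (x - y)\<bar> = \<bar>f y - f x - D * (y - x)\<bar>"
        by (subst abs_minus_cancel[symmetric]) (simp add: algebra_simps)
      ultimately show ?thesis using 3 by simp
    qed simp
  qed
qed

text \<open>
  For continuous \<open>f\<close> this is exactly the set of points where \<open>f\<close> is not differentiable.
\<close>

definition irregular_slope :: "(real \<Rightarrow> real) \<Rightarrow> real set" where
  "irregular_slope f = (\<Inter>n::nat. low_slope f (- real n)) \<union> (\<Inter>n::nat. low_slope (\<lambda>x. - f x) (- real n)) \<union>
    (\<Union>(p, q)\<in>{(p, q). p \<in> \<rat> \<and> q \<in> \<rat> \<and> p < q}. low_slope f p \<inter> low_slope (\<lambda>x. - f x) (- q))"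

lemma countable_rat_pairs: "countable {(p, q). p \<in> \<rat> \<and> q \<in> (\<rat> :: real set) \<and> p < q}"
  by (rule countable_subset[of _ "\<rat> \<times> \<rat>"]) (auto intro: countable_rat)

lemma borel_irregular_slope: "irregular_slope f \<in> sets borel"
  unfolding irregular_slope_def
  by (intro sets.Un sets.countable_INT'' sets.countable_UN'' countable_rat_pairs)
     (auto intro!: borel_low_slope sets.Int)

lemma negligible_irregular_slope:
  assumes "locally_abs_continuous f"
  shows "negligible (irregular_slope f)"
proof -
  have m: "locally_abs_continuous (\<lambda>x. - f x)"
    using assms by (simp add: locally_abs_continuous_def abs_continuous_on_minus)
  have "negligible (\<Union>(p, q)\<in>{(p, q). p \<in> \<rat> \<and> q \<in> \<rat> \<and> p < q}. low_slope f p \<inter> low_slope (\<lambda>x. - f x) (- q))"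
    by (rule negligible_countable_Union)
       (auto intro!: countable_image countable_rat_pairs negligible_oscillating_slope assms)
  then show ?thesis
    unfolding irregular_slope_def
    by (intro negligible_Un negligible_infinite_slope assms m)
qed

lemma DERIV_imp_not_irregular_slope:
  assumes "(f has_real_derivative D) (at x)"
  shows "x \<notin> irregular_slope f"
proof
  have m: "((\<lambda>x. - f x) has_real_derivative - D) (at x)" using assms by (rule DERIV_minus)
  assume "x \<in> irregular_slope f"
  then consider "\<And>n::nat. x \<in> low_slope f (- real n)" | "\<And>n::nat. x \<in> low_slope (\<lambda>x. - f x) (- real n)"
    | p q where "p < q" "x \<in> low_slope f p" "x \<in> low_slope (\<lambda>x. - f x) (- q)"
    unfolding irregular_slope_def by blast
  then show False
  proof cases
    case 1
    obtain n :: nat where "- D < real n" using reals_Archimedean2 by blast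
    with DERIV_le_low_slope[OF assms 1, of n] show False by simp
  next
    case 2
    obtain n :: nat where "D < real n" using reals_Archimedean2 by blast
    with DERIV_le_low_slope[OF m 2, of n] show False by simp
  next
    case 3
    with DERIV_le_low_slope[OF assms 3(2)] DERIV_le_low_slope[OF m 3(3)] show False by simp
  qed
qed

text \<open>The derivative is \<open>Sup S\<close>, the lower limit of the straddling quotients.
  Elements of \<open>S\<close> close to it bound the quotients from below; a number above it is a
  low slope, so the absence of oscillation bounds the quotients by any larger rational.\<close>

lemma not_irregular_slope_imp_DERIV:
  assumes cont: "isCont f x" and x: "x \<notin> irregular_slope f"
  shows "(f has_real_derivative deriv f x) (at x)"
proof -
  \<comment> \<open>Finite slopes on both sides: \<open>m\<close> shows that \<open>S\<close> is
    nonempty, \<open>n\<close> that it is bounded above.\<close>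
  obtain m n :: nat where mn: "x \<notin> low_slope f (- real m)" "x \<notin> low_slope (\<lambda>x. - f x) (- real n)"
    using x unfolding irregular_slope_def by blast
  have pq: "x \<notin> low_slope (\<lambda>x. - f x) (- q)" if "x \<in> low_slope f p" "p < q" "p \<in> \<rat>" "q \<in> \<rat>" for p q
    using x that unfolding irregular_slope_def by blast
  define S where "S = {p. x \<notin> low_slope f p}"
  have ne: "S \<noteq> {}" using mn by (auto simp: S_def)
  have "p \<le> real n" if pS: "p \<in> S" for p
  proof -
    obtain d1 where d1: "d1 > 0" "\<forall>u v. u < x \<longrightarrow> x < v \<longrightarrow> v - u < d1 \<longrightarrow> p * (v - u) \<le> f v - f u"
      using not_low_slopeD pS unfolding S_def by blast
    obtain d2 where d2: "d2 > 0" "\<forall>u v. u < x \<longrightarrow> x < v \<longrightarrow> v - u < d2 \<longrightarrow> - real n * (v - u) \<le> - f v - - f u"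
      using not_low_slopeD[OF mn(2)] by blast
    define e where "e = min d1 d2 / 3"
    have "e > 0" "2 * e < d1" "2 * e < d2" using d1(1) d2(1) by (auto simp: e_def)
    then have "p * (2 * e) \<le> f (x + e) - f (x - e)" "- real n * (2 * e) \<le> - f (x + e) - - f (x - e)"
      using d1(2)[rule_format, of "x - e" "x + e"] d2(2)[rule_format, of "x - e" "x + e"] by simp_all
    then have "p * (2 * e) \<le> real n * (2 * e)" by linarith
    then show ?thesis using \<open>e > 0\<close> by simp
  qed
  then have bdd: "bdd_above S" by (rule bdd_aboveI)
  have "(f has_real_derivative Sup S) (at x)"
  proof (rule DERIV_straddleI[OF cont])
    fix \<epsilon> :: real assume "\<epsilon> > 0"
    then obtain p where p: "p \<in> S" "Sup S - \<epsilon> < p"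
      using less_cSup_iff[OF ne bdd, of "Sup S - \<epsilon>"] by auto
    \<comment> \<open>Two rationals are fitted between \<open>Sup S\<close> and
      \<open>Sup S + \<epsilon>\<close> because \<open>irregular_slope\<close> excludes oscillation
      only across rational pairs p < q.\<close>
    obtain p' where p': "p' \<in> \<rat>" "Sup S < p'" "p' < Sup S + \<epsilon>"
      using Rats_dense_in_real[of "Sup S" "Sup S + \<epsilon>"] \<open>\<epsilon> > 0\<close> by auto
    obtain q where q: "q \<in> \<rat>" "p' < q" "q < Sup S + \<epsilon>"
      using Rats_dense_in_real[OF p'(3)] by auto
    have "p' \<notin> S" using cSup_upper[OF _ bdd, of p'] p'(2) by auto
    then have nq: "x \<notin> low_slope (\<lambda>x. - f x) (- q)" using pq p' q by (simp add: S_def)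
    obtain d1 where d1: "d1 > 0" "\<forall>u v. u < x \<longrightarrow> x < v \<longrightarrow> v - u < d1 \<longrightarrow> p * (v - u) \<le> f v - f u"
      using not_low_slopeD p(1) unfolding S_def by blast
    obtain d2 where d2: "d2 > 0" "\<forall>u v. u < x \<longrightarrow> x < v \<longrightarrow> v - u < d2 \<longrightarrow> - q * (v - u) \<le> - f v - - f u"
      using not_low_slopeD[OF nq] by blast
    show "\<exists>d>0. \<forall>u v. u < x \<longrightarrow> x < v \<longrightarrow> v - u < d \<longrightarrow> \<bar>f v - f u - Sup S * (v - u)\<bar> \<le> \<epsilon> * (v - u)"
    proof (intro exI[of _ "min d1 d2"] conjI allI impI)
      fix u v assume uv: "u < x" "x < v" "v - u < min d1 d2"
      have "(Sup S - \<epsilon>) * (v - u) \<le> p * (v - u)" "q * (v - u) \<le> (Sup S + \<epsilon>) * (v - u)"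
        using p q uv by (auto intro!: mult_right_mono)
      moreover have "p * (v - u) \<le> f v - f u" "- q * (v - u) \<le> - f v - - f u"
        using d1(2) d2(2) uv by auto
      ultimately show "\<bar>f v - f u - Sup S * (v - u)\<bar> \<le> \<epsilon> * (v - u)"
        by (simp add: algebra_simps abs_le_iff)
    qed (use d1 d2 in auto)
  qed
  then show ?thesis by (simp add: DERIV_imp_deriv)
qed

lemma locally_abs_continuous_isCont:
  assumes "locally_abs_continuous f"
  shows "isCont f x"
proof -
  have "continuous_on {x-1..x+1} f"
    using assms by (intro abs_continuous_on_imp_continuous_on) (simp add: locally_abs_continuous_def)
  then show ?thesis by (rule continuous_on_interior) simp
qed

text \<open>
  Where \<open>f\<close> is not differentiable, \<^const>\<open>deriv\<close> takes the constant junk value \<open>SOME D. False\<close>.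
\<close>

lemma borel_measurable_deriv:
  assumes cont: "\<And>x. isCont f x"
  shows "deriv f \<in> borel_measurable (borel :: real measure)"
proof (rule borel_measurable_LIMSEQ_real)
  let ?N = "irregular_slope f"
  let ?g = "\<lambda>n x. if x \<in> ?N then (SOME D::real. False) else (f (x + inverse (real (Suc n))) - f x) / inverse (real (Suc n))"
  show "(\<lambda>n. ?g n x) \<longlonglongrightarrow> deriv f x" for x
  proof (cases "x \<in> ?N")
    case True
    then have "\<not> (f has_real_derivative D) (at x)" for D
      using DERIV_imp_not_irregular_slope by blast
    with True show ?thesis by (simp add: deriv_def)
  next
    case False
    then have "(\<lambda>h. (f (x + h) - f x) / h) \<midarrow>0\<rightarrow> deriv f x"
      using not_irregular_slope_imp_DERIV[OF cont] by (simp add: DERIV_def)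
    moreover have "filterlim (\<lambda>n. inverse (real (Suc n))) (at 0) sequentially"
      unfolding filterlim_at by (simp add: LIMSEQ_inverse_real_of_nat del: of_nat_Suc)
    ultimately have "(\<lambda>n. (f (x + inverse (real (Suc n))) - f x) / inverse (real (Suc n))) \<longlonglongrightarrow> deriv f x"
      by (rule filterlim_compose)
    with False show ?thesis by (simp del: of_nat_Suc)
  qed
  have "continuous_on UNIV f" using cont by (simp add: continuous_at_imp_continuous_on)
  then have [measurable]: "f \<in> borel_measurable borel" by (rule borel_measurable_continuous_onI)
  show "?g n \<in> borel_measurable borel" for n
    by (rule measurable_If_set) (auto simp: borel_irregular_slope)
qed

section \<open>The fundamental theorem for absolutely continuous functions\<close>

text \<open>Gauge integral argument. At points off \<open>N\<close> the gauge comes from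
  differentiability. At points of \<open>N\<close> it stays within an open set of measure below
  \<open>\<delta>\<close>, so the intervals tagged there have small total increment by absolute
  continuity, while the modified integrand \<open>g\<close> vanishes at their tags.\<close>

lemma fundamental_theorem_abs_continuous:
  fixes f f' :: "real \<Rightarrow> real"
  assumes ac: "abs_continuous_on {a..b} f" and "a \<le> b" and N: "negligible N"
    and der: "\<And>x. x \<in> {a..b} - N \<Longrightarrow> (f has_real_derivative f' x) (at x)"
  shows "(f' has_integral f b - f a) {a..b}"
proof -
  define g where "g = (\<lambda>x. if x \<in> N then 0 else f' x)"
  have "(g has_integral f b - f a) (cbox a b)"
    unfolding has_integral
  proof (intro allI impI)
    fix e :: real assume "e > 0"
    \<comment> \<open>The intervals tagged off \<open>N\<close> contribute at most \<epsilon> (b -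
      a) < e / 2; the summand 1 covers a = b.\<close>
    define \<epsilon> where "\<epsilon> = e / (2 * (b - a + 1))"
    have "\<epsilon> > 0" using \<open>e > 0\<close> \<open>a \<le> b\<close> by (simp add: \<epsilon>_def)
    have "e / 2 > 0" using \<open>e > 0\<close> by simp
    obtain \<delta> where "\<delta> > 0" and \<delta>:
      "\<forall>d. d division_of \<Union>d \<longrightarrow> \<Union>d \<subseteq> {a..b} \<longrightarrow> (\<Sum>K\<in>d. measure lborel K) < \<delta> \<longrightarrow>
         (\<Sum>K\<in>d. \<bar>increment f K\<bar>) < e / 2"
      using abs_continuous_onD[OF ac \<open>e / 2 > 0\<close>] by blast
    obtain U where U: "open U" "N \<subseteq> U" "U \<in> lmeasurable" "measure lebesgue U < \<delta>"
    proof -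
      have "N \<in> sets lebesgue" using N by (simp add: negligible_imp_sets)
      then obtain T where T: "open T" "N \<subseteq> T" "T - N \<in> lmeasurable" "emeasure lebesgue (T - N) < ennreal \<delta>"
        using sets_lebesgue_outer_open[OF _ \<open>\<delta> > 0\<close>] by metis
      have lm: "T \<in> lmeasurable"
        using fmeasurable.Un[OF T(3) negligible_imp_measurable[OF N]] T(2) by (simp add: Un_absorb2)
      have "measure lebesgue T = measure lebesgue (T - N)"
        using T(3) N by (intro measure_negligible_symdiff) (auto elim!: negligible_subset)
      also have "\<dots> < \<delta>"
        using T(3,4) \<open>\<delta> > 0\<close> by (simp add: emeasure_eq_measure2 ennreal_less_iff)
      finally show thesis using T lm by (intro that[of T])
    qed
    have "\<exists>r>0. (x \<in> N \<longrightarrow> ball x r \<subseteq> U) \<and> (x \<in> {a..b} - N \<longrightarrow>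
        (\<forall>y. \<bar>y - x\<bar> < r \<longrightarrow> \<bar>f y - f x - f' x * (y - x)\<bar> \<le> \<epsilon> * \<bar>y - x\<bar>))" for x
    proof -
      consider "x \<in> N" | "x \<in> {a..b} - N" | "x \<notin> N" "x \<notin> {a..b}" by blast
      then show ?thesis
      proof cases
        case 1
        then have "x \<in> U" using U(2) by blast
        then obtain r where "r > 0" "ball x r \<subseteq> U" using U(1) openE by blast
        with 1 show ?thesis by blast
      next
        case 2
        have "\<exists>d>0. \<forall>y. norm (y - x) < d \<longrightarrow> norm (f y - f x - f' x * (y - x)) \<le> \<epsilon> * norm (y - x)"
          using der[OF 2] \<open>\<epsilon> > 0\<close> unfolding has_field_derivative_def has_derivative_at_alt by blast
        with 2 show ?thesis unfolding real_norm_def by blast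
      next
        case 3
        then show ?thesis by (intro exI[of _ 1]) auto
      qed
    qed
    then obtain r where r: "\<forall>x. r x > 0 \<and> (x \<in> N \<longrightarrow> ball x (r x) \<subseteq> U) \<and> (x \<in> {a..b} - N \<longrightarrow>
        (\<forall>y. \<bar>y - x\<bar> < r x \<longrightarrow> \<bar>f y - f x - f' x * (y - x)\<bar> \<le> \<epsilon> * \<bar>y - x\<bar>))"
      using choice[of "\<lambda>x r. r > 0 \<and> (x \<in> N \<longrightarrow> ball x r \<subseteq> U) \<and> (x \<in> {a..b} - N \<longrightarrow>
        (\<forall>y. \<bar>y - x\<bar> < r \<longrightarrow> \<bar>f y - f x - f' x * (y - x)\<bar> \<le> \<epsilon> * \<bar>y - x\<bar>))"] by auto
    show "\<exists>\<gamma>. gauge \<gamma> \<and> (\<forall>\<D>. \<D> tagged_division_of cbox a b \<and> \<gamma> fine \<D> \<longrightarrow>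
        norm ((\<Sum>(x, k)\<in>\<D>. measure lborel k *\<^sub>R g x) - (f b - f a)) < e)"
    proof (intro exI[of _ "\<lambda>x. ball x (r x)"] conjI allI impI)
      show "gauge (\<lambda>x. ball x (r x))" using r by (simp add: gauge_def)
      fix p assume *: "p tagged_division_of cbox a b \<and> (\<lambda>x. ball x (r x)) fine p"
      then have p: "p tagged_division_of {a..b}" and fine: "(\<lambda>x. ball x (r x)) fine p" by simp_all
      note pD = tagged_division_ofD[OF p]
      have fin: "finite p" by (rule pD(1))
      have K: "\<exists>u v. u \<le> x \<and> x \<le> v \<and> K = {u..v}" if "(x, K) \<in> p" for x K
        using pD(2,4)[OF that] by auto
      define q where "q = {i \<in> p. fst i \<in> N}"
      let ?S = "\<lambda>(x, K). measure lborel K * g x - increment f K"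
      have tot: "(\<Sum>(x, k)\<in>p. measure lborel k *\<^sub>R g x) - (f b - f a) = sum ?S p"
        using additive_tagged_division_1[OF \<open>a \<le> b\<close> p, of f]
        by (simp add: sum_subtractf case_prod_unfold increment_def)
      have split: "sum ?S p = sum ?S (p - q) + sum ?S q"
        using fin by (intro sum.subset_diff) (auto simp: q_def)
      have "\<bar>sum ?S (p - q)\<bar> \<le> (\<Sum>(x, K)\<in>p - q. \<epsilon> * measure lborel K)"
      proof (rule order_trans[OF sum_abs sum_mono])
        fix i assume i: "i \<in> p - q"
        obtain x K where xK: "i = (x, K)" by fastforce
        have xp: "(x, K) \<in> p" "x \<notin> N" using i xK by (auto simp: q_def)
        then obtain u v where uv: "u \<le> x" "x \<le> v" "K = {u..v}" using K by blast
        have xN: "x \<in> {a..b} - N" using pD(2,3)[OF xp(1)] xp(2) by blast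
        have "K \<subseteq> ball x (r x)" using fine xp(1) by (auto simp: fine_def)
        moreover have "u \<in> K" "v \<in> K" using uv by auto
        ultimately have uv': "u \<in> ball x (r x)" "v \<in> ball x (r x)" by blast+
        then have "\<bar>u - x\<bar> < r x" "\<bar>v - x\<bar> < r x" by (auto simp: dist_real_def abs_minus_commute)
        with xN have "\<bar>f u - f x - f' x * (u - x)\<bar> \<le> \<epsilon> * \<bar>u - x\<bar>" "\<bar>f v - f x - f' x * (v - x)\<bar> \<le> \<epsilon> * \<bar>v - x\<bar>"
          using r by blast+
        \<comment> \<open>The tag lies between the endpoints, so the two errors add up to \<epsilon>
          ((v - x) + (x - u)).\<close>
        then have "\<bar>(v - u) * f' x - (f v - f u)\<bar> \<le> \<epsilon> * (v - u)"
          using uv by (simp add: algebra_simps abs_le_iff)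
        then show "\<bar>?S i\<bar> \<le> (case i of (x, K) \<Rightarrow> \<epsilon> * measure lborel K)"
          using uv xp(2) by (simp add: xK g_def)
      qed
      also have "\<dots> \<le> (\<Sum>(x, K)\<in>p. \<epsilon> * measure lborel K)"
        using fin \<open>\<epsilon> > 0\<close> by (intro sum_mono2) auto
      also have "\<dots> = \<epsilon> * (b - a)"
        using additive_content_tagged_division[of p a b] p \<open>a \<le> b\<close>
        by (simp add: case_prod_unfold flip: sum_distrib_left)
      also have "\<dots> < e / 2"
        using \<open>e > 0\<close> \<open>a \<le> b\<close> by (simp add: \<epsilon>_def field_simps)
      finally have 1: "\<bar>sum ?S (p - q)\<bar> < e / 2" .
      have qp: "q tagged_partial_division_of {a..b}"
        using p tagged_partial_division_subset[of p "{a..b}" q] by (auto simp: q_def tagged_division_of_def)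
      have qt: "q tagged_division_of \<Union>(snd ` q)" by (rule tagged_partial_division_of_Union_self[OF qp])
      have qd: "(snd ` q) division_of \<Union>(snd ` q)" by (rule division_of_tagged_division[OF qt])
      have "\<bar>sum ?S q\<bar> \<le> (\<Sum>(x, K)\<in>q. \<bar>increment f K\<bar>)"
        by (rule order_trans[OF sum_abs sum_mono]) (auto simp: q_def g_def)
      \<comment> \<open>Passing from tagged pairs to intervals requires a function that vanishes on
        every \<open>cbox u v\<close> without interior. On the empty set \<open>increment\<close> is
        a junk value, so 0 is put there.\<close>
      also have "\<dots> = (\<Sum>(x, K)\<in>q. if K = {} then 0 else \<bar>increment f K\<bar>)"
        using pD(2) by (intro sum.cong) (fastforce simp: q_def)+
      also have "\<dots> = (\<Sum>K\<in>snd ` q. if K = {} then 0 else \<bar>increment f K\<bar>)"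
      proof (rule sum.over_tagged_division_lemma[OF qt])
        show "(if cbox u v = {} then 0 else \<bar>increment f (cbox u v)\<bar>) = 0" if "box u v = {}" for u v
          using that by (cases u v rule: linorder_cases) (auto simp: increment_def)
      qed
      also have "\<dots> = (\<Sum>K\<in>snd ` q. \<bar>increment f K\<bar>)"
        using pD(2) by (intro sum.cong) (fastforce simp: q_def)+
      also have "\<dots> < e / 2"
      proof (rule \<delta>[rule_format, OF qd])
        show "\<Union>(snd ` q) \<subseteq> {a..b}" using pD(3) by (force simp: q_def)
        have "K \<subseteq> U" if "(x, K) \<in> q" for x K
        proof -
          have "(x, K) \<in> p" "x \<in> N" using that by (auto simp: q_def)
          then have "K \<subseteq> ball x (r x)" "ball x (r x) \<subseteq> U" using fine r by (auto simp only: fine_def)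
          then show ?thesis by blast
        qed
        then have "\<Union>(snd ` q) \<subseteq> U" by fastforce
        then have "(\<Sum>K\<in>snd ` q. measure lborel K) \<le> measure lebesgue U"
          unfolding sum_content_division[OF qd] using lmeasurable_division[OF qd] U(3)
          by (intro measure_mono_fmeasurable fmeasurableD) auto
        then show "(\<Sum>K\<in>snd ` q. measure lborel K) < \<delta>" using U(4) by simp
      qed
      finally have 2: "\<bar>sum ?S q\<bar> < e / 2" .
      show "norm ((\<Sum>(x, k)\<in>p. measure lborel k *\<^sub>R g x) - (f b - f a)) < e"
        unfolding tot split using 1 2 by (simp add: real_norm_def)
    qed
  qed
  then show ?thesis
    using has_integral_spike[OF N, of "cbox a b" f' g "f b - f a"] by (simp add: g_def)
qed

lemma has_integral_deriv_abs_continuous: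
  assumes "locally_abs_continuous f" "a \<le> b"
  shows "(deriv f has_integral f b - f a) {a..b}"
proof (rule fundamental_theorem_abs_continuous)
  show "abs_continuous_on {a..b} f" using assms by (simp add: locally_abs_continuous_def)
  show "negligible (irregular_slope f)" by (rule negligible_irregular_slope) fact
  show "(f has_real_derivative deriv f x) (at x)" if "x \<in> {a..b} - irregular_slope f" for x
    using that locally_abs_continuous_isCont[OF assms(1)] by (intro not_irregular_slope_imp_DERIV) auto
qed fact

text \<open>Integrals of \<open>deriv f\<close> over intervals are increments of \<open>f\<close>,
  so on short intervals the indefinite integral has variation at most 1, which gives absolute
  integrability there. Bisection extends it to \<open>{a..b}\<close>.\<close>

lemma absolutely_integrable_deriv:
  assumes f: "locally_abs_continuous f"
  shows "deriv f absolutely_integrable_on {a..b}"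
proof (cases "a \<le> b")
  case True
  then show ?thesis
  proof (induction rule: Bolzano)
    case (trans a b c)
    then have "{a..c} = {a..b} \<union> {b..c}" by auto
    then show ?case using trans by (simp only: absolutely_integrable_Un)
  next
    case (local x)
    obtain \<delta> where "\<delta> > 0" and \<delta>: "\<forall>c d. c \<le> x \<longrightarrow> x \<le> d \<longrightarrow> d - c < \<delta> \<longrightarrow>
         (\<forall>D. D division_of \<Union>D \<longrightarrow> \<Union>D \<subseteq> {c..d} \<longrightarrow> (\<Sum>K\<in>D. \<bar>increment f K\<bar>) \<le> 1)"
      using abs_continuous_on_bounded_variation_short[OF f] by blast
    show ?case
    proof (intro exI[of _ \<delta>] conjI allI impI \<open>\<delta> > 0\<close>)
      fix c d assume cd: "c \<le> x \<and> x \<le> d \<and> d - c < \<delta>"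
      have "deriv f absolutely_integrable_on cbox c d"
      proof (rule bounded_variation_absolutely_integrable_interval)
        show "deriv f integrable_on cbox c d"
          using has_integral_deriv_abs_continuous[OF f, of c d] cd by auto
        fix D assume D: "D division_of cbox c d"
        have "(\<Sum>K\<in>D. norm (integral K (deriv f))) = (\<Sum>K\<in>D. \<bar>increment f K\<bar>)"
        proof (rule sum.cong[OF refl])
          fix K assume "K \<in> D"
          then obtain u v where "u \<le> v" "K = {u..v}" using division_ofD_Icc[OF D] by blast
          then show "norm (integral K (deriv f)) = \<bar>increment f K\<bar>"
            using has_integral_deriv_abs_continuous[OF f, of u v] by (simp add: integral_unique)
        qed
        also have "\<dots> \<le> 1"
        proof -
          have U: "\<Union>D = {c..d}" using division_ofD(6)[OF D] by simp
          then have "D division_of \<Union>D" using D by simp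
          then show ?thesis using \<delta> cd U by blast
        qed
        finally show "(\<Sum>K\<in>D. norm (integral K (deriv f))) \<le> 1" .
      qed
      then show "deriv f absolutely_integrable_on {c..d}" by simp
    qed
  qed
qed simp

text \<open>Borel measurability of \<open>deriv f\<close> transfers integrability from the completed
  measure to \<open>lborel\<close>. The variation integral in the theorem is thus a genuine value,
  not the default 0 of a nonintegrable function.\<close>

lemma set_integrable_deriv:
  assumes f: "locally_abs_continuous f"
  shows "set_integrable lborel {a..b} (deriv f)"
proof -
  have [measurable]: "deriv f \<in> borel_measurable borel"
    using locally_abs_continuous_isCont[OF f] by (rule borel_measurable_deriv)
  have "(\<lambda>x. indicator {a..b} x *\<^sub>R deriv f x) \<in> borel_measurable lborel" by measurable
  from integrable_completion[OF this] absolutely_integrable_deriv[OF f, of a b] show ?thesis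
    unfolding set_integrable_def by simp
qed

lemma abs_continuous_on_mult_Lipschitz:
  assumes f: "abs_continuous_on {a..b} f"
    and s: "\<And>x. \<bar>s x\<bar> \<le> M" "\<And>x y. \<bar>s x - s y\<bar> \<le> L * \<bar>x - y\<bar>" and "M > 0" "L > 0"
  shows "abs_continuous_on {a..b} (\<lambda>x. f x * s x)"
proof -
  have "compact (f ` {a..b})"
    using abs_continuous_on_imp_continuous_on[OF f] by (intro compact_continuous_image) auto
  then obtain B where "B > 0" and B: "\<And>x. x \<in> {a..b} \<Longrightarrow> \<bar>f x\<bar> \<le> B"
    using compact_imp_bounded bounded_pos by (metis imageI real_norm_def)
  show ?thesis unfolding abs_continuous_on_def
  proof (intro allI impI)
    fix \<epsilon> :: real assume "\<epsilon> > 0"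
    then have "\<epsilon> / (2 * M) > 0" using \<open>M > 0\<close> by simp
    then obtain \<delta> where "\<delta> > 0" and \<delta>:
      "\<forall>d. d division_of \<Union>d \<longrightarrow> \<Union>d \<subseteq> {a..b} \<longrightarrow> (\<Sum>K\<in>d. measure lborel K) < \<delta> \<longrightarrow>
       (\<Sum>K\<in>d. \<bar>increment f K\<bar>) < \<epsilon> / (2 * M)"
      using abs_continuous_onD[OF f] by blast
    show "\<exists>\<delta>>0. \<forall>d S. d division_of S \<and> S \<subseteq> {a..b} \<and> (\<Sum>k\<in>d. measure lborel k) < \<delta> \<longrightarrow>
        (\<Sum>k\<in>d. \<bar>f (Sup k) * s (Sup k) - f (Inf k) * s (Inf k)\<bar>) < \<epsilon>"
    \<comment> \<open>In the product rule for increments, the change of \<open>f\<close> costs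
      \<open>M\<close> times its variation and the change of \<open>s\<close> costs
      \<open>B * L\<close> times the total length; each share stays below \<epsilon> / 2.\<close>
    proof (intro exI[of _ "min \<delta> (\<epsilon> / (2 * B * L))"] conjI allI impI)
      show "0 < min \<delta> (\<epsilon> / (2 * B * L))" using \<open>\<delta> > 0\<close> \<open>\<epsilon> > 0\<close> \<open>B > 0\<close> \<open>L > 0\<close> by simp
      fix d S assume *: "d division_of S \<and> S \<subseteq> {a..b} \<and> (\<Sum>k\<in>d. measure lborel k) < min \<delta> (\<epsilon> / (2 * B * L))"
      then have d: "d division_of S" and S: "S \<subseteq> {a..b}" and m: "(\<Sum>k\<in>d. measure lborel k) < \<delta>"
        "(\<Sum>k\<in>d. measure lborel k) < \<epsilon> / (2 * B * L)" by auto
      have dU: "d division_of \<Union>d" "\<Union>d \<subseteq> {a..b}" using d S division_ofD(6)[OF d] by simp_all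
      have "(\<Sum>k\<in>d. \<bar>f (Sup k) * s (Sup k) - f (Inf k) * s (Inf k)\<bar>)
          \<le> (\<Sum>k\<in>d. M * \<bar>increment f k\<bar> + B * L * measure lborel k)"
      proof (rule sum_mono)
        fix k assume k: "k \<in> d"
        then obtain u v where uv: "u \<le> v" "k = {u..v}" using division_ofD_Icc[OF d] by blast
        have "u \<in> {a..b}" using division_ofD(2)[OF d k] S uv by force
        have "\<bar>f v * s v - f u * s u\<bar> = \<bar>(f v - f u) * s v + f u * (s v - s u)\<bar>" by (simp add: algebra_simps)
        also have "\<dots> \<le> \<bar>f v - f u\<bar> * \<bar>s v\<bar> + \<bar>f u\<bar> * \<bar>s v - s u\<bar>" by (metis abs_mult abs_triangle_ineq)
        also have "\<dots> \<le> \<bar>f v - f u\<bar> * M + B * (L * \<bar>v - u\<bar>)"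
          using s B[OF \<open>u \<in> {a..b}\<close>] by (intro add_mono mult_mono) auto
        finally show "\<bar>f (Sup k) * s (Sup k) - f (Inf k) * s (Inf k)\<bar> \<le> M * \<bar>increment f k\<bar> + B * L * measure lborel k"
          using uv by (simp add: mult.commute mult.left_commute)
      qed
      also have "\<dots> = M * (\<Sum>k\<in>d. \<bar>increment f k\<bar>) + B * L * (\<Sum>k\<in>d. measure lborel k)"
        by (simp add: sum.distrib sum_distrib_left)
      also have "\<dots> < M * (\<epsilon> / (2 * M)) + B * L * (\<epsilon> / (2 * B * L))"
        using \<delta> dU m \<open>M > 0\<close> \<open>B > 0\<close> \<open>L > 0\<close> by (intro add_strict_mono mult_strict_left_mono) auto
      also have "\<dots> = \<epsilon>" using \<open>M > 0\<close> \<open>B > 0\<close> \<open>L > 0\<close> by simp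
      finally show "(\<Sum>k\<in>d. \<bar>f (Sup k) * s (Sup k) - f (Inf k) * s (Inf k)\<bar>) < \<epsilon>" .
    qed
  qed
qed

section \<open>Fourier coefficients and the square error\<close>

lemma has_integral_set_borel_integral:
  fixes f :: "'a::euclidean_space \<Rightarrow> 'b::euclidean_space"
  assumes "set_integrable lborel S f"
  shows "(f has_integral (LINT x:S|lborel. f x)) S"
  unfolding has_integral_iff using set_borel_integral_eq_integral[OF assms] by simp

text \<open>Integration by parts: \<open>f * s\<close> is absolutely continuous, hence the integral
  of its derivative, and the boundary terms cancel by \<open>bd\<close>. So the integral of
  \<open>f * s'\<close> is minus that of \<open>deriv f * s\<close>.\<close>

lemma integral_deriv_times_bounded:
  fixes f s s' :: "real \<Rightarrow> real"
  assumes f: "locally_abs_continuous f" and "a \<le> b"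
    and s: "\<And>x. (s has_real_derivative s' x) (at x)" "\<And>x. \<bar>s x\<bar> \<le> M" "\<And>x. \<bar>s' x\<bar> \<le> L"
    and s': "continuous_on {a..b} s'" and "M > 0" "L > 0"
    and bd: "f b * s b = f a * s a"
  shows "\<bar>LBINT t:{a..b}. f t * s' t\<bar> \<le> M * (LBINT t:{a..b}. \<bar>deriv f t\<bar>)"
proof -
  have lip: "\<bar>s x - s y\<bar> \<le> L * \<bar>x - y\<bar>" for x y
    using field_differentiable_bound[of UNIV s s' L y x] s by (simp add: has_field_derivative_at_within abs_minus_commute)
  have ac: "abs_continuous_on {a..b} f" using f by (simp add: locally_abs_continuous_def)
  have "((\<lambda>t. deriv f t * s t + f t * s' t) has_integral f b * s b - f a * s a) {a..b}"
  proof (rule fundamental_theorem_abs_continuous[of a b "\<lambda>t. f t * s t"])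
    show "abs_continuous_on {a..b} (\<lambda>t. f t * s t)"
      by (rule abs_continuous_on_mult_Lipschitz[OF ac s(2) lip]) fact+
    show "negligible (irregular_slope f)" by (rule negligible_irregular_slope) fact
    fix x assume "x \<in> {a..b} - irregular_slope f"
    then have "(f has_real_derivative deriv f x) (at x)"
      using locally_abs_continuous_isCont[OF f] by (intro not_irregular_slope_imp_DERIV) auto
    then show "((\<lambda>t. f t * s t) has_real_derivative deriv f x * s x + f x * s' x) (at x)"
      using s(1) by (auto intro!: derivative_eq_intros)
  qed fact
  then have 0: "((\<lambda>t. deriv f t * s t + f t * s' t) has_integral 0) {a..b}" using bd by simp
  have "set_integrable lborel {a..b} (\<lambda>t. f t * s' t)"
    using abs_continuous_on_imp_continuous_on[OF ac] s'
    by (intro borel_integrable_atLeastAtMost' continuous_on_mult)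
  then have 1: "((\<lambda>t. f t * s' t) has_integral (LBINT t:{a..b}. f t * s' t)) {a..b}"
    by (rule has_integral_set_borel_integral)
  have 2: "((\<lambda>t. deriv f t * s t) has_integral - (LBINT t:{a..b}. f t * s' t)) {a..b}"
    using has_integral_diff[OF 0 1] by simp
  have int: "set_integrable lborel {a..b} (\<lambda>t. \<bar>deriv f t\<bar>)"
    using set_integrable_deriv[OF f] by (rule set_integrable_abs)
  have "norm (integral {a..b} (\<lambda>t. deriv f t * s t)) \<le> integral {a..b} (\<lambda>t. M * \<bar>deriv f t\<bar>)"
  proof (rule integral_norm_bound_integral)
    show "(\<lambda>t. deriv f t * s t) integrable_on {a..b}" using 2 by blast
    show "(\<lambda>t. M * \<bar>deriv f t\<bar>) integrable_on {a..b}"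
      using set_borel_integral_eq_integral(1)[OF int] by (intro integrable_on_mult_right)
    show "norm (deriv f t * s t) \<le> M * \<bar>deriv f t\<bar>" for t
      using mult_right_mono[OF s(2)[of t], of "\<bar>deriv f t\<bar>"] by (simp add: abs_mult mult.commute)
  qed
  then show ?thesis
    using integral_unique[OF 2] set_borel_integral_eq_integral(2)[OF int] by simp
qed

abbreviation (input) fourier_exp :: "real \<Rightarrow> int \<Rightarrow> real \<Rightarrow> complex" where
  "fourier_exp T k t \<equiv> exp (\<i> * of_real pi * of_int k * of_real t / of_real T)"

lemma fourier_exp_eq_cis: "fourier_exp T k t = cis (pi * of_int k * t / T)"
  by (simp add: cis_conv_exp mult_ac)

lemma fourier_coeff_eq_cis:
  "fourier_coeff T f k = 1 / (2 * of_real T) * (LBINT t:{0..2*T}. of_real (f t) * cis (- (pi * of_int k * t / T)))"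
  unfolding fourier_coeff_def by (simp add: cis_conv_exp mult_ac)

text \<open>Rotating the integral \<open>z\<close> by its argument makes it real, so its modulus is
  a single real integral of \<open>f\<close> against a shifted cosine. Integrating that by parts
  gives the constant without the loss of treating real and imaginary parts separately.\<close>

lemma fourier_coeff_bound:
  assumes "T > 0" and f: "locally_abs_continuous f" and per: "f (2 * T) = f 0" and "k \<noteq> 0"
  shows "cmod (fourier_coeff T f k) \<le> (LBINT t:{0..2*T}. \<bar>deriv f t\<bar>) / (2 * pi * \<bar>of_int k\<bar>)"
proof -
  define w where "w = pi * of_int k / T"
  have "w \<noteq> 0" using \<open>T > 0\<close> \<open>k \<noteq> 0\<close> by (simp add: w_def)
  define z where "z = (LBINT t:{0..2*T}. of_real (f t) * cis (- (w * t)))"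
  define V where "V = (LBINT t:{0..2*T}. \<bar>deriv f t\<bar>)"
  define \<phi> where "\<phi> = Arg z"
  have cont: "continuous_on {0..2*T} f"
    using f by (intro abs_continuous_on_imp_continuous_on) (simp add: locally_abs_continuous_def)
  have "set_integrable lborel {0..2*T} (\<lambda>t. of_real (f t) * cis (- (w * t)))"
    using cont by (intro borel_integrable_atLeastAtMost' continuous_intros)
  then have int: "set_integrable lborel {0..2*T} (\<lambda>t. cis (- \<phi>) * (of_real (f t) * cis (- (w * t))))"
    by simp
  have "of_real (cmod z) = cis (- \<phi>) * z"
  proof -
    have "z = of_real (cmod z) * cis \<phi>" by (simp add: \<phi>_def flip: rcis_def) (simp add: rcis_cmod_Arg)
    then have "cis (- \<phi>) * z = of_real (cmod z) * (cis (- \<phi>) * cis \<phi>)" by (metis mult.left_commute)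
    then show ?thesis by (simp add: cis_mult)
  qed
  also have "\<dots> = (LBINT t:{0..2*T}. cis (- \<phi>) * (of_real (f t) * cis (- (w * t))))"
    by (simp add: z_def)
  finally have "cmod z = Re (LBINT t:{0..2*T}. cis (- \<phi>) * (of_real (f t) * cis (- (w * t))))"
    by (metis Re_complex_of_real)
  also have "\<dots> = (LBINT t:{0..2*T}. Re (cis (- \<phi>) * (of_real (f t) * cis (- (w * t)))))"
    using int unfolding set_lebesgue_integral_def set_integrable_def
    by (subst integral_Re[symmetric]) simp_all
  also have "\<dots> = (LBINT t:{0..2*T}. f t * cos (w * t + \<phi>))"
  proof (rule set_lebesgue_integral_cong)
    show "\<forall>t. t \<in> {0..2*T} \<longrightarrow> Re (cis (- \<phi>) * (of_real (f t) * cis (- (w * t)))) = f t * cos (w * t + \<phi>)"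
      by (simp add: cos_add algebra_simps)
  qed simp
  also have "\<dots> \<le> \<bar>\<dots>\<bar>" by simp
  also have "\<dots> \<le> 1 / \<bar>w\<bar> * V"
    unfolding V_def
  proof (rule integral_deriv_times_bounded[where s="\<lambda>t. sin (w * t + \<phi>) / w" and L=1])
    show "((\<lambda>t. sin (w * t + \<phi>) / w) has_real_derivative cos (w * x + \<phi>)) (at x)" for x
      using \<open>w \<noteq> 0\<close> by (auto intro!: derivative_eq_intros)
    show "\<bar>sin (w * x + \<phi>) / w\<bar> \<le> 1 / \<bar>w\<bar>" for x
      by (simp add: abs_divide divide_right_mono)
    show "continuous_on {0..2*T} (\<lambda>t. cos (w * t + \<phi>))" by (intro continuous_intros)
    \<comment> \<open>The interval holds a whole number of periods of the sine, so the boundary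
      terms agree.\<close>
    have "w * (2 * T) + \<phi> = \<phi> + 2 * pi * of_int k" using \<open>T > 0\<close> by (simp add: w_def field_simps)
    then have "sin (w * (2 * T) + \<phi>) = sin \<phi>" by (metis sin_cos_eq_iff)
    then show "f (2 * T) * (sin (w * (2 * T) + \<phi>) / w) = f 0 * (sin (w * 0 + \<phi>) / w)" using per by simp
  qed (use \<open>T > 0\<close> f \<open>w \<noteq> 0\<close> in auto)
  finally have "cmod z \<le> V / \<bar>w\<bar>" by simp
  moreover have "fourier_coeff T f k = 1 / (2 * of_real T) * z"
    unfolding fourier_coeff_eq_cis z_def w_def by simp
  then have "cmod (fourier_coeff T f k) = 1 / (2 * T) * cmod z"
    using \<open>T > 0\<close> by (simp add: norm_mult norm_divide)
  ultimately have "cmod (fourier_coeff T f k) \<le> 1 / (2 * T) * (V / \<bar>w\<bar>)"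
    using mult_left_mono[of "cmod z" "V / \<bar>w\<bar>" "1 / (2 * T)"] \<open>T > 0\<close> by simp
  also have "\<dots> = V / (2 * pi * \<bar>of_int k\<bar>)"
    using \<open>T > 0\<close> by (simp add: w_def abs_mult abs_divide)
  finally show ?thesis unfolding V_def .
qed

section \<open>Orthogonality and best approximation\<close>

lemma has_integral_fourier_exp:
  assumes "T > 0"
  shows "((\<lambda>t. fourier_exp T k t) has_integral (if k = 0 then 2 * of_real T else 0)) {0..2*T}"
proof (cases "k = 0")
  case True
  then show ?thesis using has_integral_const_real[of "1::complex" 0 "2*T"] assms by (simp add: scaleR_conv_of_real)
next
  case False
  define w where "w = \<i> * of_real pi * of_int k / of_real T"
  have "w \<noteq> 0" using False assms by (simp add: w_def)
  have eq: "fourier_exp T k t = exp (w * of_real t)" for t by (simp add: w_def)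
  have "((\<lambda>t. exp (w * of_real t)) has_integral exp (w * of_real (2 * T)) / w - exp (w * of_real 0) / w) {0..2*T}"
  proof (rule fundamental_theorem_of_calculus)
    fix x :: real
    have "((\<lambda>z. exp (w * z) / w) has_field_derivative exp (w * of_real x)) (at (of_real x))"
      using \<open>w \<noteq> 0\<close> by (auto intro!: derivative_eq_intros)
    then show "((\<lambda>t. exp (w * of_real t) / w) has_vector_derivative exp (w * of_real x)) (at x within {0..2*T})"
      by (rule has_vector_derivative_real_field)
  qed (use assms in simp)
  moreover have "exp (w * of_real (2 * T)) = 1"
  proof -
    have "w * of_real (2 * T) = of_real (2 * of_int k * pi) * \<i>" using assms by (simp add: w_def)
    then show ?thesis using exp_integer_2pi[OF Ints_of_int[of k]] by (simp only:)
  qed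
  ultimately show ?thesis using False by (simp add: eq)
qed

text \<open>Expand the square, integrate by orthogonality and complete the square in the
  coefficients. With \<open>a\<close> the Fourier coefficients the last sum vanishes; for general
  \<open>a\<close> its sign is the best approximation property.\<close>

lemma has_integral_sq_error:
  fixes f :: "real \<Rightarrow> real" and a :: "int \<Rightarrow> complex"
  assumes "T > 0" and f: "continuous_on {0..2*T} f" and "finite A"
  shows "((\<lambda>t. (cmod (of_real (f t) - (\<Sum>k\<in>A. a k * fourier_exp T k t)))\<^sup>2) has_integral
    integral {0..2*T} (\<lambda>t. (f t)\<^sup>2) - 2 * T * (\<Sum>k\<in>A. (cmod (fourier_coeff T f k))\<^sup>2)
      + 2 * T * (\<Sum>k\<in>A. (cmod (a k - fourier_coeff T f k))\<^sup>2)) {0..2*T}"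
proof -
  define e where "e = (\<lambda>k t. fourier_exp T k t)"
  define c where "c = fourier_coeff T f"
  define I where "I = integral {0..2*T} (\<lambda>t. (f t)\<^sup>2)"
  have ee: "e j t * e k t = e (j + k) t" for j k t
    unfolding e_def by (simp add: add_divide_distrib distrib_left distrib_right flip: exp_add)
  have ce: "cnj (e k t) = e (- k) t" for k t unfolding e_def by (simp add: exp_cnj)
  have cc: "cnj (c k) = c (- k)" for k unfolding c_def by (rule cnj_fourier_coeff)
  have "((\<lambda>t. (f t)\<^sup>2) has_integral I) {0..2*T}"
    unfolding I_def using f by (intro integrable_integral integrable_continuous_interval continuous_intros)
  then have 1: "((\<lambda>t. of_real ((f t)\<^sup>2)) has_integral (of_real I :: complex)) {0..2*T}"
    by (rule has_integral_of_real)
  have 2: "((\<lambda>t. of_real (f t) * e (- k) t) has_integral 2 * of_real T * c k) {0..2*T}" for k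
  proof -
    have "set_integrable lborel {0..2*T} (\<lambda>t. of_real (f t) * e (- k) t)"
      unfolding e_def using f
      by (intro borel_integrable_atLeastAtMost' continuous_intros) (use assms in auto)
    then have "((\<lambda>t. of_real (f t) * e (- k) t) has_integral (LBINT t:{0..2*T}. of_real (f t) * e (- k) t)) {0..2*T}"
      by (rule has_integral_set_borel_integral)
    then show ?thesis using \<open>T > 0\<close> by (simp add: c_def e_def fourier_coeff_def)
  qed
  have 3: "((\<lambda>t. e k t) has_integral (if k = 0 then 2 * of_real T else 0)) {0..2*T}" for k
    unfolding e_def by (rule has_integral_fourier_exp) fact
  \<comment> \<open>These are the terms of (f - S)(f - cnj S) for the sum S. The exponent
    \<open>- (- k)\<close> is kept so that fact \<open>2\<close> applies at \<open>- k\<close> and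
    yields \<open>c (- k)\<close>, the conjugate of \<open>c k\<close>.\<close>
  have "((\<lambda>t. of_real ((f t)\<^sup>2) - (\<Sum>k\<in>A. cnj (a k) * (of_real (f t) * e (- k) t))
       - (\<Sum>k\<in>A. a k * (of_real (f t) * e (- (- k)) t))
       + (\<Sum>j\<in>A. \<Sum>k\<in>A. a j * cnj (a k) * e (j - k) t)) has_integral
      of_real I - (\<Sum>k\<in>A. cnj (a k) * (2 * of_real T * c k)) - (\<Sum>k\<in>A. a k * (2 * of_real T * c (- k)))
       + (\<Sum>j\<in>A. \<Sum>k\<in>A. a j * cnj (a k) * (if j - k = 0 then 2 * of_real T else 0))) {0..2*T}"
    by (intro has_integral_add has_integral_diff has_integral_sum has_integral_mult_right 1 2 3 assms)
  moreover have "of_real ((f t)\<^sup>2) - (\<Sum>k\<in>A. cnj (a k) * (of_real (f t) * e (- k) t))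
       - (\<Sum>k\<in>A. a k * (of_real (f t) * e (- (- k)) t))
       + (\<Sum>j\<in>A. \<Sum>k\<in>A. a j * cnj (a k) * e (j - k) t)
     = complex_of_real ((cmod (of_real (f t) - (\<Sum>k\<in>A. a k * e k t)))\<^sup>2)" for t
  proof -
    define S where "S = (\<Sum>k\<in>A. a k * e k t)"
    have cS: "cnj S = (\<Sum>k\<in>A. cnj (a k) * e (- k) t)" by (simp add: S_def ce)
    have "(\<Sum>j\<in>A. \<Sum>k\<in>A. a j * cnj (a k) * e (j - k) t) = S * cnj S"
      unfolding S_def cS[unfolded S_def] sum_product diff_conv_add_uminus ee[symmetric] by (simp only: mult_ac)
    moreover have "(\<Sum>k\<in>A. cnj (a k) * (of_real (f t) * e (- k) t)) = of_real (f t) * cnj S"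
      unfolding cS sum_distrib_left by (simp only: mult_ac)
    moreover have "(\<Sum>k\<in>A. a k * (of_real (f t) * e (- (- k)) t)) = of_real (f t) * S"
      unfolding S_def sum_distrib_left by (simp add: mult_ac)
    ultimately show ?thesis
      unfolding complex_norm_square S_def[symmetric] by (simp add: algebra_simps power2_eq_square)
  qed
  moreover have "of_real I - (\<Sum>k\<in>A. cnj (a k) * (2 * of_real T * c k)) - (\<Sum>k\<in>A. a k * (2 * of_real T * c (- k)))
       + (\<Sum>j\<in>A. \<Sum>k\<in>A. a j * cnj (a k) * (if j - k = 0 then 2 * of_real T else 0))
     = complex_of_real (I - 2 * T * (\<Sum>k\<in>A. (cmod (c k))\<^sup>2) + 2 * T * (\<Sum>k\<in>A. (cmod (a k - c k))\<^sup>2))"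
  proof -
    have "(\<Sum>j\<in>A. \<Sum>k\<in>A. a j * cnj (a k) * (if j - k = 0 then 2 * of_real T else 0)) = (\<Sum>j\<in>A. a j * cnj (a j) * (2 * of_real T))"
      using \<open>finite A\<close> by (intro sum.cong refl) (simp add: if_distrib cong: if_cong)
    moreover have "(\<Sum>k\<in>A. (a k - c k) * (cnj (a k) - cnj (c k))) =
        (\<Sum>k\<in>A. a k * cnj (a k)) - (\<Sum>k\<in>A. cnj (a k) * c k) - (\<Sum>k\<in>A. a k * cnj (c k)) + (\<Sum>k\<in>A. c k * cnj (c k))"
      by (simp add: algebra_simps sum.distrib sum_subtractf)
    ultimately show ?thesis
      unfolding cc[symmetric] of_real_add of_real_diff of_real_mult of_real_sum complex_norm_square complex_cnj_diff
      by (simp add: sum_distrib_left[symmetric] sum_distrib_right[symmetric] mult.left_commute[of _ "2 * complex_of_real T"] ring_distribs)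
  qed
  ultimately have "((\<lambda>t. complex_of_real ((cmod (of_real (f t) - (\<Sum>k\<in>A. a k * e k t)))\<^sup>2)) has_integral
      complex_of_real (I - 2 * T * (\<Sum>k\<in>A. (cmod (c k))\<^sup>2) + 2 * T * (\<Sum>k\<in>A. (cmod (a k - c k))\<^sup>2))) {0..2*T}"
    by (simp only:)
  from has_integral_linear[OF this bounded_linear_Re] show ?thesis by (simp add: o_def I_def c_def e_def)
qed

section \<open>Approximation by trigonometric polynomials\<close>

definition trig_polynomial :: "real \<Rightarrow> (real \<Rightarrow> complex) \<Rightarrow> bool" where
  "trig_polynomial T p \<longleftrightarrow> (\<exists>A a. finite A \<and> p = (\<lambda>t. \<Sum>k\<in>A. a k * fourier_exp T k t))"

lemma trig_polynomial_monom: "trig_polynomial T (\<lambda>t. c * fourier_exp T k t)"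
  unfolding trig_polynomial_def by (intro exI[of _ "{k}"] exI[of _ "\<lambda>_. c"]) simp

lemma trig_polynomial_const: "trig_polynomial T (\<lambda>t. c)"
  using trig_polynomial_monom[of T c 0] by simp

lemma trig_polynomial_add:
  assumes "trig_polynomial T p" "trig_polynomial T q"
  shows "trig_polynomial T (\<lambda>t. p t + q t)"
proof -
  obtain A a where A: "finite A" "p = (\<lambda>t. \<Sum>k\<in>A. a k * fourier_exp T k t)"
    using assms(1) unfolding trig_polynomial_def by blast
  obtain B b where B: "finite B" "q = (\<lambda>t. \<Sum>k\<in>B. b k * fourier_exp T k t)"
    using assms(2) unfolding trig_polynomial_def by blast
  define c where "c = (\<lambda>k. (if k \<in> A then a k else 0) + (if k \<in> B then b k else 0))"
  have "p t + q t = (\<Sum>k\<in>A \<union> B. c k * fourier_exp T k t)" for t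
  proof -
    have "p t = (\<Sum>k\<in>A \<union> B. (if k \<in> A then a k else 0) * fourier_exp T k t)"
      unfolding A(2) using A(1) B(1) by (intro sum.mono_neutral_cong_left) auto
    moreover have "q t = (\<Sum>k\<in>A \<union> B. (if k \<in> B then b k else 0) * fourier_exp T k t)"
      unfolding B(2) using A(1) B(1) by (intro sum.mono_neutral_cong_left) auto
    ultimately show ?thesis by (simp only: c_def distrib_right sum.distrib)
  qed
  then show ?thesis
    unfolding trig_polynomial_def using A(1) B(1) by (intro exI[of _ "A \<union> B"] exI[of _ c]) auto
qed

lemma trig_polynomial_sum:
  assumes "finite I" "\<And>i. i \<in> I \<Longrightarrow> trig_polynomial T (p i)"
  shows "trig_polynomial T (\<lambda>t. \<Sum>i\<in>I. p i t)"
  using assms by (induction I rule: finite_induct) (simp_all add: trig_polynomial_const trig_polynomial_add)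

lemma trig_polynomial_mult:
  assumes "trig_polynomial T p" "trig_polynomial T q"
  shows "trig_polynomial T (\<lambda>t. p t * q t)"
proof -
  obtain A a where A: "finite A" "p = (\<lambda>t. \<Sum>k\<in>A. a k * fourier_exp T k t)"
    using assms(1) unfolding trig_polynomial_def by blast
  obtain B b where B: "finite B" "q = (\<lambda>t. \<Sum>k\<in>B. b k * fourier_exp T k t)"
    using assms(2) unfolding trig_polynomial_def by blast
  have "p t * q t = (\<Sum>j\<in>A. \<Sum>k\<in>B. (a j * b k) * fourier_exp T (j + k) t)" for t
  proof -
    have "fourier_exp T (j + k) t = fourier_exp T j t * fourier_exp T k t" for j k
      by (simp add: add_divide_distrib distrib_left distrib_right flip: exp_add)
    then show ?thesis unfolding A(2) B(2) sum_product by (simp only: mult_ac)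
  qed
  then show ?thesis
    using A(1) B(1) by (simp only:) (intro trig_polynomial_sum trig_polynomial_monom)
qed

text \<open>Real polynomials on the plane are what Stone-Weierstrass yields. On the circle a
  real-linear form is a combination of cosine and sine, hence of the frequencies 1 and -1; sums and
  products stay trigonometric.\<close>

lemma trig_polynomial_real_polynomial_function:
  fixes p :: "complex \<Rightarrow> real"
  assumes "real_polynomial_function p"
  shows "trig_polynomial T (\<lambda>t. of_real (p (cis (pi * t / T))))"
  using assms
proof induction
  case (linear L)
  interpret bounded_linear L by fact
  have "complex_of_real (L (cis (pi * t / T))) =
      (of_real (L 1) / 2 + of_real (L \<i>) / (2 * \<i>)) * fourier_exp T 1 t
      + (of_real (L 1) / 2 - of_real (L \<i>) / (2 * \<i>)) * fourier_exp T (- 1) t" for t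
  proof -
    have "L (cis (pi * t / T)) = L (cos (pi * t / T) *\<^sub>R 1 + sin (pi * t / T) *\<^sub>R \<i>)"
      by (rule arg_cong[of _ _ L]) (simp add: complex_eq_iff)
    also have "\<dots> = cos (pi * t / T) * L 1 + sin (pi * t / T) * L \<i>"
      by (simp add: add scaleR)
    finally show ?thesis
      unfolding fourier_exp_eq_cis by (simp add: complex_eq_iff field_simps)
  qed
  then show ?case
    by (simp only:) (intro trig_polynomial_add trig_polynomial_monom)
next
  case (const c)
  then show ?case by (simp add: trig_polynomial_const)
next
  case (add f g)
  then show ?case by (simp add: trig_polynomial_add)
next
  case (mult f g)
  then show ?case by (simp add: trig_polynomial_mult)
qed

lemma periodic_int:
  fixes f :: "real \<Rightarrow> 'a" and n :: int
  assumes "\<And>t. f (t + P) = f t"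
  shows "f (t + of_int n * P) = f t"
proof (induction n rule: int_induct[of _ 0])
  case (step1 i)
  then show ?case using assms[of "t + of_int i * P"] by (simp add: algebra_simps)
next
  case (step2 i)
  then show ?case using assms[of "t + of_int (i - 1) * P"] by (simp add: algebra_simps)
qed simp

text \<open>
  The lift \<open>w \<mapsto> f (T / \<pi> * Arg w)\<close> of a periodic function to the circle is continuous even across the
  branch cut: by periodicity, \<open>Arg w\<close> may be replaced by \<open>Arg (- w) + \<pi>\<close>, whose cut is on the other side.
\<close>

lemma trig_polynomial_approx:
  fixes f :: "real \<Rightarrow> real"
  assumes "T > 0" and cont: "\<And>t. isCont f t" and per: "\<And>t. f (t + 2 * T) = f t" and "\<epsilon> > 0"
  shows "\<exists>p. trig_polynomial T p \<and> (\<forall>t. cmod (of_real (f t) - p t) < \<epsilon>)"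
proof -
  define G where "G = (\<lambda>w. f (T / pi * Arg w))"
  have cis_eq: "f (T / pi * \<alpha>) = f (T / pi * \<beta>)" if "cis \<alpha> = cis \<beta>" for \<alpha> \<beta>
  proof -
    have "sin \<alpha> = sin \<beta> \<and> cos \<alpha> = cos \<beta>" using that by (simp add: complex_eq_iff)
    then obtain n :: int where "\<alpha> = \<beta> + 2 * pi * of_int n" unfolding sin_cos_eq_iff by blast
    then have "T / pi * \<alpha> = T / pi * \<beta> + of_int n * (2 * T)" by (simp add: field_simps)
    then show ?thesis using periodic_int[of f "2 * T", OF per] by simp
  qed
  have cisArg: "cis (Arg w) = w" if "w \<in> sphere 0 1" for w
    using that cis_Arg[of w] by (cases "w = 0") (auto simp: sgn_eq)
  have "continuous_on (sphere 0 1) G"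
    unfolding continuous_on_eq_continuous_within
  proof
    fix z :: complex assume z: "z \<in> sphere 0 1"
    show "continuous (at z within sphere 0 1) G"
    proof (cases "z \<in> \<real>\<^sub>\<le>\<^sub>0")
      case False
      then have "isCont (\<lambda>w. T / pi * Arg w) z"
        by (intro continuous_intros continuous_at_Arg)
      then have "isCont G z" unfolding G_def by (rule isCont_o2) (rule cont)
      then show ?thesis by (rule continuous_at_imp_continuous_at_within)
    next
      case True
      let ?H = "\<lambda>w. f (T / pi * (Arg (- w) + pi))"
      have "z \<noteq> 0" using z by auto
      then have "- z \<notin> \<real>\<^sub>\<le>\<^sub>0" using True by (auto simp: complex_nonpos_Reals_iff complex_eq_iff)
      then have "isCont (\<lambda>w. Arg (- w)) z"
        by (intro isCont_o2[where g=Arg and f=uminus] continuous_intros continuous_at_Arg)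
      then have "isCont (\<lambda>w. T / pi * (Arg (- w) + pi)) z" by (intro continuous_intros)
      then have "isCont ?H z" by (rule isCont_o2) (rule cont)
      then have "continuous (at z within sphere 0 1) ?H" by (rule continuous_at_imp_continuous_at_within)
      moreover have "?H w = G w" if "w \<in> sphere 0 1" for w
        unfolding G_def
      proof (rule cis_eq)
        have "- w \<in> sphere 0 1" using that by simp
        then show "cis (Arg (- w) + pi) = cis (Arg w)"
          using cisArg that by (simp flip: cis_mult)
      qed
      ultimately show ?thesis
        using continuous_transform_within[of z "sphere 0 1" ?H 1 G] z by simp
    qed
  qed
  then obtain p where p: "real_polynomial_function p" "\<And>w. w \<in> sphere 0 1 \<Longrightarrow> \<bar>G w - p w\<bar> < \<epsilon>"
    using Stone_Weierstrass_real_polynomial_function[of "sphere 0 1" G \<epsilon>] \<open>\<epsilon> > 0\<close> by auto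
  show ?thesis
  proof (intro exI conjI allI)
    show "trig_polynomial T (\<lambda>t. of_real (p (cis (pi * t / T))))"
      by (rule trig_polynomial_real_polynomial_function) fact
    fix t
    let ?w = "cis (pi * t / T)"
    have w: "?w \<in> sphere 0 1" by simp
    have "G ?w = f (T / pi * (pi * t / T))"
      unfolding G_def by (rule cis_eq) (rule cisArg[OF w])
    also have "\<dots> = f t" using \<open>T > 0\<close> by simp
    finally have "\<bar>f t - p ?w\<bar> < \<epsilon>" using p(2)[OF w] by simp
    then show "cmod (of_real (f t) - of_real (p ?w)) < \<epsilon>"
      by (simp flip: of_real_diff)
  qed
qed

section \<open>Tail estimate, convergence of the square error, and conclusion\<close>

lemma sum_symmetric_tail_le:
  fixes g :: "int \<Rightarrow> real"
  assumes g: "\<And>k. k \<noteq> 0 \<Longrightarrow> g k \<le> M / (of_int k)\<^sup>2" and "K \<ge> 1" "K \<le> N" and "M \<ge> 0"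
  shows "(\<Sum>k=-int N..int N. g k) \<le> (\<Sum>k=-int K..int K. g k) + 2 * M * (1 / real K - 1 / real N)"
  using \<open>K \<le> N\<close>
proof (induction N rule: dec_induct)
  case (step n)
  have "n \<ge> 1" using step \<open>K \<ge> 1\<close> by simp
  have eq: "{-int (Suc n)..int (Suc n)} = insert (int (Suc n)) (insert (- int (Suc n)) {-int n..int n})" by auto
  have "(\<Sum>k=-int (Suc n)..int (Suc n). g k) = g (int (Suc n)) + (g (- int (Suc n)) + (\<Sum>k=-int n..int n. g k))"
    unfolding eq by (subst sum.insert; (subst sum.insert)?) auto
  moreover have "g (int (Suc n)) \<le> M / (real (Suc n))\<^sup>2" "g (- int (Suc n)) \<le> M / (real (Suc n))\<^sup>2"
    using g[of "int (Suc n)"] g[of "- int (Suc n)"] by (simp_all add: power2_eq_square del: of_nat_Suc)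
  \<comment> \<open>Comparing 1 / (n + 1)^2 with 1 / (n (n + 1)) makes the bound telescope; the
    frequencies n + 1 and -(n + 1) account for the factor 2.\<close>
  moreover have "M / (real (Suc n))\<^sup>2 \<le> M * (1 / real n - 1 / real (Suc n))"
  proof -
    have "1 / (real (Suc n))\<^sup>2 \<le> 1 / (real n * real (Suc n))"
      unfolding power2_eq_square using \<open>n \<ge> 1\<close> by (intro divide_left_mono mult_right_mono) auto
    also have "\<dots> = 1 / real n - 1 / real (Suc n)"
      using \<open>n \<ge> 1\<close> by (simp add: field_simps)
    finally have "1 / (real (Suc n))\<^sup>2 \<le> 1 / real n - 1 / real (Suc n)" .
    then show ?thesis using \<open>M \<ge> 0\<close> mult_left_mono[of _ _ M] by fastforce
  qed
  moreover have "2 * M * (1 / real K - 1 / real (Suc n)) =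
      2 * M * (1 / real K - 1 / real n) + 2 * (M * (1 / real n - 1 / real (Suc n)))"
    by (simp add: algebra_simps del: of_nat_Suc)
  ultimately show ?case using step.IH by linarith
qed simp

lemma square_error_eq:
  assumes "T > 0" "continuous_on {0..2*T} f"
  shows "square_error T f K =
    integral {0..2*T} (\<lambda>t. (f t)\<^sup>2) - 2 * T * (\<Sum>k=-int K..int K. (cmod (fourier_coeff T f k))\<^sup>2)"
proof -
  have "set_integrable lborel {0..2*T} (\<lambda>t. (cmod (of_real (f t) - fourier_trunc T f K t))\<^sup>2)"
    unfolding fourier_trunc_def using assms
    by (intro borel_integrable_atLeastAtMost' continuous_intros) auto
  from has_integral_set_borel_integral[OF this]
  have "((\<lambda>t. (cmod (of_real (f t) - fourier_trunc T f K t))\<^sup>2) has_integral square_error T f K) {0..2*T}"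
    unfolding square_error_def .
  then show ?thesis
    using has_integral_sq_error[OF assms, of "{-int K..int K}" "fourier_coeff T f"]
    unfolding fourier_trunc_def by (simp add: has_integral_unique)
qed

text \<open>The convergence part of Parseval: a uniformly close trigonometric polynomial has small
  square error, and the Fourier sum over any symmetric range containing its frequencies does at
  least as well.\<close>

lemma exists_square_error_le:
  fixes f :: "real \<Rightarrow> real"
  assumes "T > 0" and cont: "\<And>t. isCont f t" and per: "\<And>t. f (t + 2 * T) = f t" and "\<epsilon> > 0"
  shows "\<exists>N\<ge>K. square_error T f N \<le> \<epsilon>"
proof -
  define \<eta> where "\<eta> = sqrt (\<epsilon> / (2 * T))"
  have "\<eta> > 0" and \<eta>2: "\<eta>\<^sup>2 = \<epsilon> / (2 * T)" using \<open>T > 0\<close> \<open>\<epsilon> > 0\<close> by (simp_all add: \<eta>_def)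
  have con: "continuous_on {0..2*T} f" using cont by (simp add: continuous_at_imp_continuous_on)
  obtain p where "trig_polynomial T p" and p: "\<And>t. cmod (of_real (f t) - p t) < \<eta>"
    using trig_polynomial_approx[OF assms(1-3) \<open>\<eta> > 0\<close>] by blast
  then obtain A a where A: "finite A" "p = (\<lambda>t. \<Sum>k\<in>A. a k * fourier_exp T k t)"
    unfolding trig_polynomial_def by blast
  \<comment> \<open>All frequencies in \<open>A\<close> lie between -N and N; inserting 0 keeps
    \<open>Max\<close> meaningful for empty \<open>A\<close>.\<close>
  define N where "N = max K (Max (insert 0 ((\<lambda>k. nat \<bar>k\<bar>) ` A)))"
  define b where "b = (\<lambda>k. if k \<in> A then a k else 0)"
  have "A \<subseteq> {-int N..int N}"
  proof
    fix k assume "k \<in> A"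
    then have "nat \<bar>k\<bar> \<le> N" using A(1) by (auto simp: N_def intro!: max.coboundedI2 Max_ge)
    then show "k \<in> {-int N..int N}" by auto
  qed
  then have "p t = (\<Sum>k=-int N..int N. b k * fourier_exp T k t)" for t
    unfolding A(2) b_def by (intro sum.mono_neutral_cong_left) auto
  then have 1: "((\<lambda>t. (cmod (of_real (f t) - p t))\<^sup>2) has_integral
      square_error T f N + 2 * T * (\<Sum>k=-int N..int N. (cmod (b k - fourier_coeff T f k))\<^sup>2)) {0..2*T}"
    using has_integral_sq_error[OF \<open>T > 0\<close> con, of "{-int N..int N}" b] square_error_eq[OF \<open>T > 0\<close> con, of N]
    by simp
  have 2: "((\<lambda>t. \<eta>\<^sup>2) has_integral 2 * T * \<eta>\<^sup>2) {0..2*T}"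
    using has_integral_const_real[of "\<eta>\<^sup>2" 0 "2*T"] \<open>T > 0\<close> by simp
  have "square_error T f N + 2 * T * (\<Sum>k=-int N..int N. (cmod (b k - fourier_coeff T f k))\<^sup>2) \<le> 2 * T * \<eta>\<^sup>2"
    using p by (intro has_integral_le[OF 1 2] power_mono) (auto intro: less_imp_le)
  moreover have "0 \<le> 2 * T * (\<Sum>k=-int N..int N. (cmod (b k - fourier_coeff T f k))\<^sup>2)"
    using \<open>T > 0\<close> by (simp add: sum_nonneg)
  ultimately have "square_error T f N \<le> 2 * T * \<eta>\<^sup>2" by linarith
  then have "square_error T f N \<le> \<epsilon>" using \<open>T > 0\<close> by (simp add: \<eta>2)
  moreover have "N \<ge> K" by (simp add: N_def)
  ultimately show ?thesis by blast
qed

theorem mainTheorem1: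
  fixes T C :: real and \<gamma> :: "real \<Rightarrow> real" and K :: nat
  assumes "T > 0"
    and "C \<ge> 0"
    and "\<And>t. \<gamma> (t + 2 * T) = \<gamma> t"
    and "locally_abs_continuous \<gamma>"
    and "(LBINT t:{0..2*T}. \<bar>deriv \<gamma> t\<bar>) \<le> C"
    and "K \<ge> 1"
  shows "square_error T \<gamma> K \<le> T * C\<^sup>2 / (pi\<^sup>2 * real K)"
proof (rule field_le_epsilon)
  fix \<epsilon> :: real assume "\<epsilon> > 0"
  have cont: "isCont \<gamma> t" for t by (rule locally_abs_continuous_isCont) fact
  then have con: "continuous_on {0..2*T} \<gamma>" by (simp add: continuous_at_imp_continuous_on)
  \<comment> \<open>The square of the coefficient bound without its factor 1 / |k|;
    \<open>4 * T * M\<close> is \<open>T * C\<^sup>2 / pi\<^sup>2\<close>.\<close>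
  define M where "M = (C / (2 * pi))\<^sup>2"
  have "M \<ge> 0" by (simp add: M_def)
  have g: "(cmod (fourier_coeff T \<gamma> k))\<^sup>2 \<le> M / (of_int k)\<^sup>2" if "k \<noteq> 0" for k
  proof -
    have "cmod (fourier_coeff T \<gamma> k) \<le> (LBINT t:{0..2*T}. \<bar>deriv \<gamma> t\<bar>) / (2 * pi * \<bar>of_int k\<bar>)"
      using fourier_coeff_bound[OF assms(1,4) _ that] assms(3)[of 0] by simp
    also have "\<dots> \<le> C / (2 * pi * \<bar>of_int k\<bar>)"
      using assms(5) by (simp add: divide_right_mono)
    finally have "(cmod (fourier_coeff T \<gamma> k))\<^sup>2 \<le> (C / (2 * pi * \<bar>of_int k\<bar>))\<^sup>2"
      by (rule power_mono) simp
    then show ?thesis by (simp add: M_def power_divide power_mult_distrib)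
  qed
  \<comment> \<open>The errors at \<open>K\<close> and \<open>N\<close> differ by 2 T times the sum
    of the squared coefficients with K < |k| \<le> N. As the error at \<open>N\<close> is at most
    \<open>\<epsilon>\<close>, finite sums suffice and no infinite series is formed.\<close>
  obtain N where N: "N \<ge> K" "square_error T \<gamma> N \<le> \<epsilon>"
    using exists_square_error_le[OF assms(1) cont assms(3) \<open>\<epsilon> > 0\<close>] by blast
  let ?S = "\<lambda>N. \<Sum>k=-int N..int N. (cmod (fourier_coeff T \<gamma> k))\<^sup>2"
  have "?S N \<le> ?S K + 2 * M * (1 / real K - 1 / real N)"
    by (rule sum_symmetric_tail_le) (use g assms(6) N(1) \<open>M \<ge> 0\<close> in auto)
  also have "\<dots> \<le> ?S K + 2 * M * (1 / real K)"
    using \<open>M \<ge> 0\<close> by (intro add_left_mono mult_left_mono) auto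
  finally have "2 * T * ?S N \<le> 2 * T * (?S K + 2 * M * (1 / real K))"
    using assms(1) by simp
  then have "square_error T \<gamma> K \<le> square_error T \<gamma> N + 4 * T * M / real K"
    unfolding square_error_eq[OF assms(1) con] by (simp add: algebra_simps)
  also have "4 * T * M / real K = T * C\<^sup>2 / (pi\<^sup>2 * real K)"
    by (simp add: M_def power_divide power_mult_distrib)
  finally show "square_error T \<gamma> K \<le> T * C\<^sup>2 / (pi\<^sup>2 * real K) + \<epsilon>" using N(2) by simp
qed

end
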